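(* Let $\theta,a,b>0$. Let $(v_n)_{n\ge1}$ be i.i.d. $Be(1,\theta)$ random variables and let $v\sim Be(a,b)$ be independent of $(v_n)_{n\ge1}$. Let $P=\sum_{n\ge1}w_n\delta_{z_n}$ with $w_n=v_n\prod_{j=1}^{n-1}(1-v_j)$ (a Dirichlet process) and $P'=\sum_{n\ge1}w_n'\delta_{z_n}$ with $w_n'=v(1-v)^{n-1}$ (a geometric process), sharing the same locations $(z_n)_{n\ge1}$. Let $\rho=\frac{1}{\theta+1}$. Then $$\mathbb{E}\big(D_{\mathrm{KL}}(P\|P')\big)=(\theta+1)\,\mathbb{E}\big(d(v_1\|v)\big),$$ where $$\mathbb{E}\big(d(v_1\|v)\big)=\rho\,[\psi(2)-\psi(\theta+2)-\psi(a)+\psi(a+b)]+(1-\rho)\,[-\rho-\psi(b)+\psi(a+b)],$$ and $$\mathrm{Var}\big(D_{\mathrm{KL}}(P\|P')\big)=(\theta+1)(\theta+2)\,\mathbb{E}\big((1-v_1)\,d(v_1\|v)\,d(v_2\|v)\big)+\frac{\theta+2}{2}\,\mathbb{E}\big(d(v_1\|v)^2\big)-\big[(\theta+1)\,\mathbb{E}(d(v_1\|v))\big]^2 .$$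
   Context: $Be(a,b)$ is the beta distribution with mean $a/(a+b)$; $\psi=\Gamma'/\Gamma$ is the digamma function. The locations $(z_n)_{n\ge1}$ are i.i.d. from a non-atomic probability distribution $P_0$ on a Polish space and independent of the weights. Since the locations are shared, the Kullback-Leibler divergence is the random variable $D_{\mathrm{KL}}(P\|P')=\sum_{n=1}^\infty w_n\log\frac{w_n}{w_n'}$ (the series converges almost surely). The binary divergence is, for $x,y\in(0,1)$, $d(x\|y)=x\log\frac{x}{y}+(1-x)\log\frac{1-x}{1-y}$. The number $\rho$ is the tie probability of the Dirichlet process with parameter $\theta$. *)

theory Defs
  imports "HOL-Probability.Probability"
begin

definition beta_density :: "real \<Rightarrow> real \<Rightarrow> real \<Rightarrow> real" where
  "beta_density a b x =
     (if 0 < x \<and> x < 1 then x powr (a - 1) * (1 - x) powr (b - 1) / Beta a b else 0)"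

(* The library's indep_var requires both variables to have the same value type;
   this is the same notion for two arbitrary value spaces. *)
definition (in prob_space) indep_rv ::
  "'b measure \<Rightarrow> ('a \<Rightarrow> 'b) \<Rightarrow> 'c measure \<Rightarrow> ('a \<Rightarrow> 'c) \<Rightarrow> bool" where
  "indep_rv N X K Y \<longleftrightarrow>
     random_variable N X \<and> random_variable K Y \<and>
     indep_set {X -` A \<inter> space M | A. A \<in> sets N} {Y -` A \<inter> space M | A. A \<in> sets K}"

(* All sequences are indexed from 0, so index n here is index n + 1 in the usual
   enumeration of sticks, weights and locations. *)
definition stick_weight :: "(nat \<Rightarrow> real) \<Rightarrow> nat \<Rightarrow> real" where
  "stick_weight v n = v n * (\<Prod>j<n. 1 - v j)"

definition geometric_weight :: "real \<Rightarrow> nat \<Rightarrow> real" where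
  "geometric_weight v n = v * (1 - v) ^ n"

(* The discrete measure placing mass w n at z n, as the push-forward under z of the
   measure on the naturals with point masses w. *)
definition discrete_measure ::
  "(nat \<Rightarrow> real) \<Rightarrow> (nat \<Rightarrow> 'x::topological_space) \<Rightarrow> 'x measure" where
  "discrete_measure w z = distr (density (count_space UNIV) (\<lambda>n. ennreal (w n))) borel z"

lemma emeasure_discrete_measure:
  assumes "A \<in> sets borel"
  shows "emeasure (discrete_measure w z) A = (\<Sum>n. ennreal (w n) * indicator A (z n))"
proof -
  have "emeasure (discrete_measure w z) A =
      (\<integral>\<^sup>+ n. ennreal (w n) * indicator (z -` A) n \<partial>count_space UNIV)"
    using assms by (simp add: discrete_measure_def emeasure_distr emeasure_density)
  also have "\<dots> = (\<Sum>n. ennreal (w n) * indicator A (z n))"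
    by (simp add: nn_integral_count_space_nat indicator_def)
  finally show ?thesis .
qed

definition kl_series :: "(nat \<Rightarrow> real) \<Rightarrow> (nat \<Rightarrow> real) \<Rightarrow> real" where
  "kl_series w w' = (\<Sum>n. w n * ln (w n / w' n))"

(* Only meaningful for arguments strictly between 0 and 1. *)
definition binary_div :: "real \<Rightarrow> real \<Rightarrow> real" where
  "binary_div x y = x * ln (x / y) + (1 - x) * ln ((1 - x) / (1 - y))"

end

theory Submission
  imports Defs
begin

text \<open>
  Write \<open>R\<^sub>n = (1 - v\<^sub>0) \<dots> (1 - v\<^bsub>n-1\<^esub>)\<close> for the part of the stick left after \<open>n\<close> breaks and
  \<open>d\<^sub>n\<close> for the binary divergence of \<open>v\<^sub>n\<close> from \<open>v\<close>.  Almost surely the locations are pairwise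
  distinct, so the divergence of the two random measures is the series
  \<open>\<Sum>\<^sub>n w\<^sub>n ln (w\<^sub>n / w'\<^sub>n)\<close> (\<open>KL_divergence_discrete_measure\<close>).  The logarithm splits as
  \<open>ln (v\<^sub>n / v) + \<Sum>\<^bsub>j<n\<^esub> ln ((1 - v\<^sub>j) / (1 - v))\<close>, and the weights beyond index \<open>j\<close> add up to
  \<open>R\<^bsub>j+1\<^esub> = R\<^sub>j (1 - v\<^sub>j)\<close>.  Summation by parts therefore gives
  \<open>D = \<Sum>\<^sub>n R\<^sub>n d\<^sub>n\<close>, a series of nonnegative terms (\<open>kl_sums\<close>, \<open>AE_KL_sums\<close>); this is the chain rule for relative entropy:
  both measures choose a location by successive decisions "stop here or go on", and \<open>R\<^sub>n d\<^sub>n\<close> is the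
  contribution of the decision at location \<open>n\<close>.

  Conditionally on \<open>v\<close> the sticks are i.i.d. (\<open>nn_integral_conditionally_iid\<close>), so \<open>R\<^sub>n\<close> separates
  from \<open>d\<^sub>n\<close>.  With \<open>q = E(1 - v\<^sub>0) = \<theta>/(\<theta>+1)\<close> and \<open>r = E((1 - v\<^sub>0)\<^sup>2) = \<theta>/(\<theta>+2)\<close> this yields
  \<open>E(R\<^sub>n d\<^sub>n) = q\<^sup>n E(d\<^sub>0)\<close> and \<open>E((R\<^sub>n d\<^sub>n)\<^sup>2) = r\<^sup>n E(d\<^sub>0\<^sup>2)\<close> (\<open>nn_integral_term_power\<close>); and, for
  \<open>m < n\<close>, splitting the product at \<open>m\<close>,
  \<open>E(R\<^sub>m d\<^sub>m R\<^sub>n d\<^sub>n) = r\<^sup>m q\<^bsup>n-m-1\<^esup> E((1 - v\<^sub>0) d\<^sub>0 d\<^sub>1)\<close> (\<open>nn_integral_cross_term\<close>).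
  Summing the geometric series with \<open>1/(1-q) = \<theta>+1\<close> and \<open>1/(1-r) = (\<theta>+2)/2\<close> gives both moments
  of \<open>D\<close>.  All terms are nonnegative, so the interchange of sum and expectation is monotone
  convergence.  The expectations on the right are finite because
  \<open>0 \<le> d\<^sub>n \<le> - ln v - ln (1 - v)\<close> (\<open>binary_div_nonneg\<close>, \<open>binary_div_le\<close>) and the logarithms of a beta
  variable are square integrable.  The closed form of \<open>E(d\<^sub>0)\<close> comes from the logarithmic moments of
  the beta distribution, which are derivatives of the beta function
  (\<open>has_bochner_integral_beta_ln\<close>).
\<close>

section \<open>The beta distribution\<close>

lemma beta_density_nonneg: "0 < a \<Longrightarrow> 0 < b \<Longrightarrow> 0 \<le> beta_density a b x"
  by (simp add: beta_density_def Beta_def Gamma_real_pos less_imp_le)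

lemma Beta_pos: "0 < a \<Longrightarrow> 0 < b \<Longrightarrow> 0 < Beta a (b::real)"
  by (simp add: Beta_def Gamma_real_pos)

lemma borel_measurable_beta_density [measurable]: "beta_density a b \<in> borel_measurable borel"
  unfolding beta_density_def [abs_def] by measurable

lemma has_bochner_integral_beta_density:
  assumes "0 < a" "0 < b"
  shows "has_bochner_integral lborel (beta_density a b) 1"
proof -
  define k where "k t = t powr (a - 1) * (1 - t) powr (b - 1)" for t :: real
  have si: "set_integrable lborel {0..1} k"
    using integrable_Beta[OF assms] unfolding k_def .
  have int: "(LINT t:{0..1}|lborel. k t) = Beta a b"
    using set_borel_integral_eq_integral(2)[OF si]
      integral_unique[OF has_integral_Beta_real[OF assms]] by (simp add: k_def [abs_def])
  have "has_bochner_integral lborel (\<lambda>t. indicator {0..1} t *\<^sub>R k t) (Beta a b)"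
    using si int unfolding set_integrable_def set_lebesgue_integral_def
    by (simp add: has_bochner_integral_iff)
  then have "has_bochner_integral lborel (\<lambda>t. (indicator {0..1} t *\<^sub>R k t) / Beta a b)
      (Beta a b / Beta a b)"
    by (intro has_bochner_integral_divide_zero)
  moreover have "(\<lambda>t. (indicator {0..1} t *\<^sub>R k t) / Beta a b) = beta_density a b"
    by (auto simp: fun_eq_iff beta_density_def k_def indicator_def)
  ultimately show ?thesis using Beta_pos[OF assms] by simp
qed

text \<open>
  Multiplying by \<open>x\<close> raises the first parameter by one.  This turns every moment with a factor
  \<open>x\<close> or \<open>1 - x\<close> into one for a beta distribution with shifted parameters.
\<close>
lemma size_biased_beta_density:
  assumes "0 < a" "0 < b"
  shows "beta_density a b x * x = a / (a + b) * beta_density (a + 1) b x"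
proof (cases "0 < x \<and> x < 1")
  case True
  have "Beta (a + 1) b = a / (a + b) * Beta a b"
    using Beta_plus1_left[of a b] nonpos_Ints_nonpos[of a] assms by (fastforce simp: field_simps)
  moreover have "x powr a = x powr (a - 1) * x"
    using True by (simp add: powr_diff)
  ultimately show ?thesis
    using True assms Beta_pos[of a b] by (simp add: beta_density_def field_simps)
qed (auto simp: beta_density_def)

lemma beta_density_reflect: "beta_density a b (1 - x) = beta_density b a x"
  by (auto simp: beta_density_def Beta_commute)

lemma size_biased_beta_density_compl:
  assumes "0 < a" "0 < b"
  shows "beta_density a b x * (1 - x) = b / (a + b) * beta_density a (b + 1) x"
  using size_biased_beta_density[OF assms(2,1), of "1 - x"]
    beta_density_reflect[of b a x] beta_density_reflect[of "b + 1" a x]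
  by (simp add: add.commute)

lemma has_bochner_integral_reflect:
  assumes "has_bochner_integral lborel f (c::real)"
  shows "has_bochner_integral lborel (\<lambda>x::real. f (1 - x)) c"
  using lborel_has_bochner_integral_real_affine_iff[of "-1" f c 1] assms by simp

lemma abs_ln_le_powr:
  assumes "0 < x" "x \<le> 1" "0 < (c::real)"
  shows "\<bar>ln x\<bar> \<le> x powr (- c) / c"
proof -
  have "1 + (- c * ln x) \<le> exp (- c * ln x)" by (rule exp_ge_add_one_self)
  also have "\<dots> = x powr (- c)" using assms by (simp add: powr_def)
  finally show ?thesis using assms ln_le_zero_iff[of x] by (simp add: field_simps)
qed

lemma beta_density_powr:
  assumes "0 < a" "0 < b" "0 < a + s"
  shows "beta_density a b x * x powr s = Beta (a + s) b / Beta a b * beta_density (a + s) b x"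
  using assms Beta_pos[of a b] Beta_pos[of "a + s" b]
  by (auto simp: beta_density_def field_simps simp flip: powr_add)

lemma has_bochner_integral_beta_powr:
  assumes "0 < a" "0 < b" "0 < a + s"
  shows "has_bochner_integral lborel (\<lambda>x. beta_density a b x * x powr s) (Beta (a + s) b / Beta a b)"
  unfolding beta_density_powr[OF assms]
  using has_bochner_integral_mult_right[OF has_bochner_integral_beta_density[OF assms(3,2)],
      of "Beta (a + s) b / Beta a b"] by simp

text \<open>
  The bound \<open>\<bar>ln x\<bar> \<le> x\<^bsup>-c\<^esup> / c\<close> trades each logarithm for an arbitrarily small negative power, so
  \<open>k\<close> logarithms cost only a decrease of \<open>a\<close> by \<open>k c\<close>.
\<close>
lemma integrable_beta_ln_power:
  assumes "0 < a" "0 < b"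
  shows "integrable lborel (\<lambda>x. beta_density a b x * \<bar>ln x\<bar> ^ k)"
proof (cases "k = 0")
  case True
  then show ?thesis
    using has_bochner_integral_beta_density[OF assms] by (simp add: has_bochner_integral_iff)
next
  case False
  \<comment> \<open>the \<open>k\<close> logarithms together cost half of the exponent \<open>a\<close>\<close>
  define c where "c = a / (2 * k)"
  have c: "0 < c" using False assms by (simp add: c_def)
  have ck: "c * real k = a / 2" using False by (simp add: c_def)
  have "integrable lborel (\<lambda>x. (beta_density a b x * x powr (- a / 2)) / c ^ k)"
    using has_bochner_integral_beta_powr[OF assms, of "- a / 2"] assms
    by (intro integrable_divide) (auto simp: has_bochner_integral_iff)
  then show ?thesis
  proof (rule Bochner_Integration.integrable_bound)
    show "AE x in lborel. norm (beta_density a b x * \<bar>ln x\<bar> ^ k)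
        \<le> norm (beta_density a b x * x powr (- a / 2) / c ^ k)"
    proof (rule AE_I2)
      fix x
      show "norm (beta_density a b x * \<bar>ln x\<bar> ^ k)
          \<le> norm (beta_density a b x * x powr (- a / 2) / c ^ k)"
      proof (cases "0 < x \<and> x < 1")
        case True
        have "\<bar>ln x\<bar> ^ k \<le> (x powr (- c) / c) ^ k"
          using abs_ln_le_powr[of x c] True c by (intro power_mono) auto
        also have "\<dots> = x powr (- a / 2) / c ^ k"
          using True by (simp add: power_divide powr_powr ck flip: powr_realpow)
        finally show ?thesis
          using beta_density_nonneg[OF assms, of x] c
          by (simp add: abs_mult power_abs mult_left_mono flip: times_divide_eq_right)
      qed (auto simp: beta_density_def)
    qed
  qed simp
qed

text \<open>
  Differentiation under the integral sign: \<open>x\<^sup>a ln x\<close> is the derivative of \<open>x\<^sup>a\<close> in \<open>a\<close>, so the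
  integral is the logarithmic derivative of the beta function in its first argument.  The
  difference quotients \<open>(x\<^sup>h - 1) / h\<close> with \<open>h > 0\<close> are dominated by \<open>\<bar>ln x\<bar>\<close>.
\<close>
lemma has_bochner_integral_beta_ln:
  assumes "0 < a" "0 < b"
  shows "has_bochner_integral lborel (\<lambda>x. beta_density a b x * ln x) (Digamma a - Digamma (a + b))"
proof -
  define h where "h n = inverse (real (Suc n))" for n
  define f where "f n x = beta_density a b x * ((x powr h n - 1) / h n)" for n x
  have h: "0 < h n" for n by (simp add: h_def)
  have h0: "filterlim h (at 0) sequentially"
    using LIMSEQ_inverse_real_of_nat h
    by (simp add: filterlim_at h_def [abs_def] less_imp_neq[symmetric])
  have int_f: "has_bochner_integral lborel (f n) ((Beta (a + h n) b - Beta a b) / h n / Beta a b)" for n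
  proof -
    have "has_bochner_integral lborel (\<lambda>x. (beta_density a b x * x powr h n - beta_density a b x) / h n)
        ((Beta (a + h n) b / Beta a b - 1) / h n)"
      using assms h[of n]
      by (intro has_bochner_integral_divide_zero has_bochner_integral_diff
          has_bochner_integral_beta_powr has_bochner_integral_beta_density) auto
    moreover have "(\<lambda>x. (beta_density a b x * x powr h n - beta_density a b x) / h n) = f n"
      by (auto simp: f_def fun_eq_iff field_simps)
    moreover have "(Beta (a + h n) b / Beta a b - 1) / h n = (Beta (a + h n) b - Beta a b) / h n / Beta a b"
      using Beta_pos[OF assms] by (simp add: field_simps)
    ultimately show ?thesis by simp
  qed
  have dom: "integrable lborel (\<lambda>x. beta_density a b x * \<bar>ln x\<bar>)"
    using integrable_beta_ln_power[OF assms, of 1] by simp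
  have lim: "(\<lambda>n. f n x) \<longlonglongrightarrow> beta_density a b x * ln x" for x
  proof (cases "0 < x \<and> x < 1")
    case True
    have "((\<lambda>s. x powr s) has_real_derivative ln x) (at 0)"
      using True by (auto intro!: derivative_eq_intros)
    then have "((\<lambda>s. (x powr s - 1) / s) \<longlongrightarrow> ln x) (at 0)"
      using True by (simp add: has_field_derivative_iff)
    then have "(\<lambda>n. (x powr h n - 1) / h n) \<longlonglongrightarrow> ln x"
      by (rule filterlim_compose[OF _ h0])
    then show ?thesis unfolding f_def by (intro tendsto_intros)
  qed (auto simp: f_def beta_density_def)
  have bound: "norm (f n x) \<le> beta_density a b x * \<bar>ln x\<bar>" for n x
  proof (cases "0 < x \<and> x < 1")
    case True
    \<comment> \<open>\<open>h ln x \<le> x\<^sup>h - 1 \<le> 0\<close>, so the difference quotient lies between \<open>ln x\<close> and \<open>0\<close>\<close>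
    have "1 + h n * ln x \<le> x powr h n"
      using exp_ge_add_one_self[of "h n * ln x"] True by (simp add: powr_def)
    moreover have "x powr h n \<le> 1" using True h[of n] by (simp add: powr_le1)
    ultimately have "\<bar>(x powr h n - 1) / h n\<bar> \<le> \<bar>ln x\<bar>"
      using True h[of n] ln_less_zero[of x] by (simp add: field_simps abs_if)
    then show ?thesis
      using beta_density_nonneg[OF assms, of x] by (simp add: f_def abs_mult mult_left_mono flip: times_divide_eq_right)
  qed (auto simp: f_def beta_density_def)
  have [measurable]: "f n \<in> borel_measurable lborel" for n
    using int_f[of n] by (intro borel_measurable_integrable) (simp add: has_bochner_integral_iff)
  have int: "integrable lborel (\<lambda>x. beta_density a b x * ln x)"
    by (rule integrable_dominated_convergence[OF _ _ dom, where s = f]) (use lim bound in auto)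
  have "(\<lambda>n. integral\<^sup>L lborel (f n)) \<longlonglongrightarrow> (\<integral>x. beta_density a b x * ln x \<partial>lborel)"
    by (rule integral_dominated_convergence[OF _ _ dom]) (use lim bound in auto)
  moreover have "(\<lambda>n. integral\<^sup>L lborel (f n)) \<longlonglongrightarrow> Digamma a - Digamma (a + b)"
  proof -
    have "((\<lambda>x. Beta x b) has_real_derivative Beta a b * (Digamma a - Digamma (a + b))) (at a)"
      using assms by (intro has_field_derivative_Beta1) (auto elim!: nonpos_Ints_cases)
    then have "((\<lambda>s. (Beta (a + s) b - Beta a b) / s) \<longlongrightarrow> Beta a b * (Digamma a - Digamma (a + b))) (at 0)"
      by (simp add: DERIV_def)
    then have "(\<lambda>n. (Beta (a + h n) b - Beta a b) / h n / Beta a b)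
        \<longlonglongrightarrow> Beta a b * (Digamma a - Digamma (a + b)) / Beta a b"
      using Beta_pos[OF assms] by (intro tendsto_divide filterlim_compose[OF _ h0] tendsto_const) auto
    then show ?thesis
      using int_f Beta_pos[OF assms] by (simp add: has_bochner_integral_iff)
  qed
  ultimately show ?thesis
    using int LIMSEQ_unique by (auto simp: has_bochner_integral_iff)
qed

lemma has_bochner_integral_distributed:
  assumes "distributed M lborel X (\<lambda>x. ennreal (f x))" "\<And>x. 0 \<le> f x" "g \<in> borel_measurable borel"
    "has_bochner_integral lborel (\<lambda>x. f x * g x) c"
  shows "has_bochner_integral M (\<lambda>\<omega>. g (X \<omega>) :: real) c"
  using distributed_integrable[OF assms(1), of g] distributed_integral[OF assms(1), of g] assms
  by (simp add: has_bochner_integral_iff)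

context
  fixes M :: "'w measure" and X a b
  assumes X: "distributed M lborel X (\<lambda>x. ennreal (beta_density a b x))"
    and a: "0 < a" and b: "0 < b"
begin

lemmas beta_rv_integral = has_bochner_integral_distributed[OF X beta_density_nonneg[OF a b]]

lemma beta_rv_in_unit: 
  assumes M: "prob_space M"
  shows "AE \<omega> in M. 0 < X \<omega> \<and> X \<omega> < 1"
  by (subst prob_space.distributed_AE2[OF M X]) (auto simp: beta_density_def)

lemma beta_rv_ln: "has_bochner_integral M (\<lambda>\<omega>. ln (X \<omega>)) (Digamma a - Digamma (a + b))"
  by (intro beta_rv_integral has_bochner_integral_beta_ln a b) simp

lemma beta_rv_ln_compl: "has_bochner_integral M (\<lambda>\<omega>. ln (1 - X \<omega>)) (Digamma b - Digamma (a + b))"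
  using has_bochner_integral_reflect[OF has_bochner_integral_beta_ln[OF b a]]
  by (intro beta_rv_integral) (simp_all add: beta_density_reflect add.commute)

lemma beta_rv_ln_sq: "integrable M (\<lambda>\<omega>. (ln (X \<omega>))\<^sup>2)"
  using beta_rv_integral[of "\<lambda>x. (ln x)\<^sup>2"] integrable_beta_ln_power[OF a b, of 2]
  by (auto simp: has_bochner_integral_iff)

lemma beta_rv_ln_compl_sq: "integrable M (\<lambda>\<omega>. (ln (1 - X \<omega>))\<^sup>2)"
  using beta_rv_integral[of "\<lambda>x. (ln (1 - x))\<^sup>2"] integrable_beta_ln_power[OF b a, of 2]
    has_bochner_integral_reflect[of "\<lambda>x. beta_density b a x * (ln x)\<^sup>2"]
  by (auto simp: has_bochner_integral_iff beta_density_reflect)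

lemma beta_rv_mult_ln:
  "has_bochner_integral M (\<lambda>\<omega>. X \<omega> * ln (X \<omega>)) (a / (a + b) * (Digamma (a + 1) - Digamma (a + b + 1)))"
proof (rule beta_rv_integral)
  show "has_bochner_integral lborel (\<lambda>x. beta_density a b x * (x * ln x))
      (a / (a + b) * (Digamma (a + 1) - Digamma (a + b + 1)))"
    using has_bochner_integral_mult_right[OF has_bochner_integral_beta_ln[of "a + 1" b], of "a / (a + b)"] a b
    by (simp add: size_biased_beta_density mult.assoc[symmetric] add_ac del: times_divide_eq_left)
qed simp

lemma beta_rv_mult_ln_compl:
  "has_bochner_integral M (\<lambda>\<omega>. (1 - X \<omega>) * ln (1 - X \<omega>))
     (b / (a + b) * (Digamma (b + 1) - Digamma (a + b + 1)))"
proof (rule beta_rv_integral)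
  show "has_bochner_integral lborel (\<lambda>x. beta_density a b x * ((1 - x) * ln (1 - x)))
      (b / (a + b) * (Digamma (b + 1) - Digamma (a + b + 1)))"
    using has_bochner_integral_mult_right[OF
        has_bochner_integral_reflect[OF has_bochner_integral_beta_ln[of "b + 1" a]], of "b / (a + b)"] a b
    by (simp add: size_biased_beta_density_compl beta_density_reflect
        mult.assoc[symmetric] add_ac del: times_divide_eq_left)
qed simp

lemma beta_rv_mean: "has_bochner_integral M X (a / (a + b))"
  using has_bochner_integral_mult_right[OF has_bochner_integral_beta_density[of "a + 1" b], of "a / (a + b)"] a b
  by (intro beta_rv_integral[where g = "\<lambda>x. x"])
    (simp_all add: size_biased_beta_density del: times_divide_eq_left)

lemma beta_rv_compl: "has_bochner_integral M (\<lambda>\<omega>. 1 - X \<omega>) (b / (a + b))"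
  using has_bochner_integral_mult_right[OF has_bochner_integral_beta_density[of a "b + 1"], of "b / (a + b)"] a b
  by (intro beta_rv_integral) (simp_all add: size_biased_beta_density_compl del: times_divide_eq_left)

lemma beta_rv_compl_sq:
  "has_bochner_integral M (\<lambda>\<omega>. (1 - X \<omega>)\<^sup>2) (b * (b + 1) / ((a + b) * (a + b + 1)))"
proof (rule beta_rv_integral)
  have "beta_density a b x * (1 - x)\<^sup>2
      = b / (a + b) * ((b + 1) / (a + (b + 1))) * beta_density a (b + 1 + 1) x" for x
    using size_biased_beta_density_compl[of a b x] size_biased_beta_density_compl[of a "b + 1" x] a b
    by (simp only: power2_eq_square mult.assoc[symmetric]) (simp add: mult.assoc)
  then show "has_bochner_integral lborel (\<lambda>x. beta_density a b x * (1 - x)\<^sup>2)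
      (b * (b + 1) / ((a + b) * (a + b + 1)))"
    using has_bochner_integral_mult_right[OF has_bochner_integral_beta_density[of a "b + 1 + 1"],
        of "b / (a + b) * ((b + 1) / (a + (b + 1)))"] a b
    by (simp add: add_ac mult_ac)
qed simp

end

section \<open>Divergence of discrete measures with common atoms\<close>

text \<open>
  Distinct atoms let the ratio of the weights be read off from the location, which makes it a
  function on the space of locations, hence a density.
\<close>
lemma discrete_measure_density:
  fixes z :: "nat \<Rightarrow> 'x::polish_space"
  assumes z: "inj z" and w: "\<And>n. 0 < w n" and w': "\<And>n. 0 < w' n"
  defines "f \<equiv> \<lambda>x. \<Sum>n. w n / w' n * indicator {z n} x"
  shows "f \<in> borel_measurable borel"
    and "f (z m) = w m / w' m"
    and "density (discrete_measure w' z) f = discrete_measure w z"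
proof -
  have [measurable]: "{z n} \<in> sets borel" for n by simp
  show f_meas [measurable]: "f \<in> borel_measurable borel"
    unfolding f_def by (intro borel_measurable_suminf) measurable
  have fz: "f (z m) = w m / w' m" for m
  proof -
    have "(\<lambda>n. w n / w' n * indicator {z n} (z m)) sums (\<Sum>n\<in>{m}. w n / w' n * indicator {z n} (z m))"
      by (intro sums_finite) (use z in \<open>auto simp: indicator_def inj_eq\<close>)
    then show ?thesis unfolding f_def by (simp add: sums_iff)
  qed
  show "f (z m) = w m / w' m" by (rule fz)
  have "density (discrete_measure w' z) f =
      distr (density (density (count_space UNIV) (\<lambda>n. ennreal (w' n))) (\<lambda>n. ennreal (f (z n)))) borel z"
    unfolding discrete_measure_def by (subst density_distr) auto
  also have "density (density (count_space UNIV) (\<lambda>n. ennreal (w' n))) (\<lambda>n. ennreal (f (z n))) =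
      density (count_space UNIV) (\<lambda>n. ennreal (w' n) * ennreal (f (z n)))"
    by (subst density_density_eq) auto
  also have "(\<lambda>n. ennreal (w' n) * ennreal (f (z n))) = (\<lambda>n. ennreal (w n))"
    using w' by (auto simp: fz fun_eq_iff less_imp_le less_imp_neq[OF w', symmetric] simp flip: ennreal_mult')
  finally show "density (discrete_measure w' z) f = discrete_measure w z"
    by (simp add: discrete_measure_def)
qed

text \<open>
  The Lebesgue integral defining the divergence needs absolute convergence.  A convergent series
  is enough for that, because \<open>w ln (w / w') \<ge> w - w' \<ge> - w'\<close> bounds the negative parts by a
  summable sequence.
\<close>
lemma summable_abs_kl_terms:
  fixes w w' :: "nat \<Rightarrow> real"
  assumes w: "\<And>n. 0 < w n" and w': "\<And>n. 0 < w' n"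
    and sum: "summable w'" and kl: "summable (\<lambda>n. w n * ln (w n / w' n))"
  shows "summable (\<lambda>n. \<bar>w n * ln (w n / w' n)\<bar>)"
proof -
  have "\<bar>w n * ln (w n / w' n)\<bar> \<le> w n * ln (w n / w' n) + 2 * w' n" for n
  proof -
    have "ln (w' n / w n) \<le> w' n / w n - 1"
      using w[of n] w'[of n] by (intro ln_le_minus_one) simp
    then have "1 - w' n / w n \<le> ln (w n / w' n)"
      using w[of n] w'[of n] by (simp add: ln_div)
    then have "w n * (1 - w' n / w n) \<le> w n * ln (w n / w' n)"
      using w[of n] by (intro mult_left_mono) simp_all
    then have "w n - w' n \<le> w n * ln (w n / w' n)"
      using w[of n] by (simp add: right_diff_distrib)
    then show ?thesis using w[of n] w'[of n] by linarith
  qed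
  then have bound: "norm \<bar>w n * ln (w n / w' n)\<bar> \<le> w n * ln (w n / w' n) + 2 * w' n" for n by simp
  have "summable (\<lambda>n. w n * ln (w n / w' n) + 2 * w' n)"
    by (intro summable_add summable_mult kl sum)
  then show ?thesis by (rule summable_comparison_test'[where N = 0]) (rule bound)
qed

lemma KL_divergence_discrete_measure:
  fixes z :: "nat \<Rightarrow> 'x::polish_space"
  assumes z: "inj z" and w: "\<And>n. 0 < w n" and w': "\<And>n. 0 < w' n"
    and sum: "summable w'" and kl: "summable (\<lambda>n. w n * ln (w n / w' n))"
  shows "absolutely_continuous (discrete_measure w' z) (discrete_measure w z)"
    and "KL_divergence (exp 1) (discrete_measure w' z) (discrete_measure w z) = kl_series w w'"
proof -
  let ?P' = "discrete_measure w' z"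
  obtain f :: "'x \<Rightarrow> real" where f [measurable]: "f \<in> borel_measurable borel"
    and fz: "\<And>m. f (z m) = w m / w' m"
    and dens: "density ?P' f = discrete_measure w z"
    using discrete_measure_density[where z = z and w = w and w' = w', OF z w w'] by blast
  have [measurable_cong]: "sets ?P' = sets borel" by (simp add: discrete_measure_def)
  have emP: "emeasure ?P' (space ?P') = ennreal (suminf w')"
    using suminf_ennreal2[OF less_imp_le[OF w'] sum]
    by (simp add: discrete_measure_def emeasure_discrete_measure[unfolded discrete_measure_def])
  interpret P': finite_measure ?P'
    by (rule finite_measureI) (simp add: emP)
  show "absolutely_continuous ?P' (discrete_measure w z)"
    unfolding dens[symmetric] by (intro absolutely_continuousI_density) measurable
  have "AE x in ?P'. 0 \<le> f x"
    unfolding discrete_measure_def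
    by (subst AE_distr_iff) (use w w' in \<open>auto simp: AE_density AE_count_space fz less_imp_le\<close>)
  then have "KL_divergence (exp 1) ?P' (discrete_measure w z) = (\<integral>x. f x * log (exp 1) (f x) \<partial>?P')"
    unfolding dens[symmetric] by (intro P'.KL_density) auto
  also have "\<dots> = (\<integral>n. f (z n) * ln (f (z n)) \<partial>density (count_space UNIV) (\<lambda>n. ennreal (w' n)))"
    unfolding discrete_measure_def log_def by (subst integral_distr) auto
  also have "\<dots> = (\<integral>n. w' n * (f (z n) * ln (f (z n))) \<partial>count_space UNIV)"
    using w' by (subst integral_real_density) (auto simp: less_imp_le)
  also have "\<dots> = (\<integral>n. w n * ln (w n / w' n) \<partial>count_space UNIV)"
  proof -
    have "w' n * (w n / w' n * ln (w n / w' n)) = w n * ln (w n / w' n)" for n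
      using w'[of n] by simp
    then show ?thesis unfolding fz by simp
  qed
  also have "\<dots> = kl_series w w'"
    unfolding kl_series_def using summable_abs_kl_terms[OF w w' sum kl]
    by (intro integral_count_space_nat) (simp add: integrable_count_space_nat_iff)
  finally show "KL_divergence (exp 1) ?P' (discrete_measure w z) = kl_series w w'" .
qed

section \<open>Independence of two random variables with different value spaces\<close>

lemma (in prob_space) distr_indep_rv:
  assumes indep: "indep_rv N X K Y"
  shows "distr M (N \<Otimes>\<^sub>M K) (\<lambda>\<omega>. (X \<omega>, Y \<omega>)) = distr M N X \<Otimes>\<^sub>M distr M K Y"
proof -
  have [measurable]: "X \<in> measurable M N" "Y \<in> measurable M K"
    and set: "indep_set {X -` A \<inter> space M |A. A \<in> sets N} {Y -` A \<inter> space M |A. A \<in> sets K}"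
    using indep unfolding indep_rv_def by auto
  interpret X: prob_space "distr M N X" by (rule prob_space_distr) measurable
  interpret Y: prob_space "distr M K Y" by (rule prob_space_distr) measurable
  have "distr M N X \<Otimes>\<^sub>M distr M K Y = distr M (N \<Otimes>\<^sub>M K) (\<lambda>\<omega>. (X \<omega>, Y \<omega>))"
  proof (rule pair_measure_eqI)
    show "sigma_finite_measure (distr M N X)" "sigma_finite_measure (distr M K Y)" by unfold_locales
    show "sets (distr M N X \<Otimes>\<^sub>M distr M K Y) = sets (distr M (N \<Otimes>\<^sub>M K) (\<lambda>\<omega>. (X \<omega>, Y \<omega>)))"
      by (simp cong: sets_pair_measure_cong)
  next
    fix A B assume A: "A \<in> sets (distr M N X)" and B: "B \<in> sets (distr M K Y)"
    then have [measurable]: "A \<in> sets N" "B \<in> sets K" by auto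
    have "prob ((X -` A \<inter> space M) \<inter> (Y -` B \<inter> space M)) =
        prob (X -` A \<inter> space M) * prob (Y -` B \<inter> space M)"
      using \<open>A \<in> sets N\<close> \<open>B \<in> sets K\<close> by (intro indep_setD[OF set]) auto
    moreover have "(\<lambda>\<omega>. (X \<omega>, Y \<omega>)) -` (A \<times> B) \<inter> space M =
        (X -` A \<inter> space M) \<inter> (Y -` B \<inter> space M)" by auto
    ultimately show "emeasure (distr M N X) A * emeasure (distr M K Y) B =
        emeasure (distr M (N \<Otimes>\<^sub>M K) (\<lambda>\<omega>. (X \<omega>, Y \<omega>))) (A \<times> B)"
      by (simp add: emeasure_distr emeasure_eq_measure ennreal_mult)
  qed
  then show ?thesis by simp
qed

text \<open>
  Tonelli's theorem for the joint law, which is the product of the marginal laws.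
\<close>
lemma (in prob_space) nn_integral_indep_rv:
  assumes indep: "indep_rv N X K Y" and f [measurable]: "f \<in> borel_measurable (N \<Otimes>\<^sub>M K)"
  shows "(\<integral>\<^sup>+\<omega>. f (X \<omega>, Y \<omega>) \<partial>M) = (\<integral>\<^sup>+\<omega>'. \<integral>\<^sup>+\<omega>. f (X \<omega>', Y \<omega>) \<partial>M \<partial>M)"
proof -
  have [measurable]: "X \<in> measurable M N" "Y \<in> measurable M K"
    using indep unfolding indep_rv_def by auto
  interpret Y: prob_space "distr M K Y" by (rule prob_space_distr) measurable
  have f': "f \<in> borel_measurable (distr M N X \<Otimes>\<^sub>M distr M K Y)" by measurable
  have "(\<integral>\<^sup>+\<omega>. f (X \<omega>, Y \<omega>) \<partial>M) = integral\<^sup>N (distr M (N \<Otimes>\<^sub>M K) (\<lambda>\<omega>. (X \<omega>, Y \<omega>))) f"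
    by (subst nn_integral_distr) auto
  also have "\<dots> = (\<integral>\<^sup>+x. \<integral>\<^sup>+y. f (x, y) \<partial>distr M K Y \<partial>distr M N X)"
    unfolding distr_indep_rv[OF indep] by (rule Y.nn_integral_fst[OF f', symmetric])
  also have "\<dots> = (\<integral>\<^sup>+\<omega>'. \<integral>\<^sup>+y. f (X \<omega>', y) \<partial>distr M K Y \<partial>M)"
    by (intro nn_integral_distr) measurable
  also have "\<dots> = (\<integral>\<^sup>+\<omega>'. \<integral>\<^sup>+\<omega>. f (X \<omega>', Y \<omega>) \<partial>M \<partial>M)"
    by (intro nn_integral_cong nn_integral_distr) measurable
  finally show ?thesis .
qed

lemma (in prob_space) indep_rv_of_indep_vars:
  assumes X: "indep_vars N X I" and ij: "i \<in> I" "j \<in> I" "i \<noteq> j"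
  shows "indep_rv (N i) (X i) (N j) (X j)"
proof -
  have rv: "X i \<in> measurable M (N i)" "X j \<in> measurable M (N j)"
    using X ij by (auto simp: indep_vars_def)
  have "prob ((X i -` A \<inter> space M) \<inter> (X j -` B \<inter> space M)) =
      prob (X i -` A \<inter> space M) * prob (X j -` B \<inter> space M)"
    if "A \<in> sets (N i)" "B \<in> sets (N j)" for A B
  proof -
    let ?C = "\<lambda>k. if k = i then A else B"
    have "prob (\<Inter>k\<in>{i, j}. X k -` ?C k \<inter> space M) = (\<Prod>k\<in>{i, j}. prob (X k -` ?C k \<inter> space M))"
      by (rule indep_varsD[OF X]) (use that ij in auto)
    then show ?thesis using ij by simp
  qed
  then show ?thesis
    using rv unfolding indep_rv_def indep_sets2_eq by (auto intro: measurable_sets)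
qed

text \<open>
  Two locations coincide with probability \<open>(P0 \<Otimes> P0)(diagonal)\<close>, which is the integral of
  \<open>P0 {x}\<close>, that is, zero; and there are only countably many pairs.
\<close>
lemma (in prob_space) AE_inj_iid_nonatomic:
  fixes z :: "nat \<Rightarrow> 'a \<Rightarrow> 'x::polish_space"
  assumes z: "indep_vars (\<lambda>_. borel) z UNIV" and law: "\<And>n. distr M borel (z n) = P0"
    and nonatomic: "\<And>x. emeasure P0 {x} = 0"
  shows "AE \<omega> in M. inj (\<lambda>n. z n \<omega>)"
proof -
  have [measurable]: "z n \<in> borel_measurable M" for n
    using z by (simp add: indep_vars_def)
  have "AE \<omega> in M. z i \<omega> \<noteq> z j \<omega>" if "i \<noteq> j" for i j
  proof -
    interpret P0: prob_space P0
      unfolding law[of 0, symmetric] by (rule prob_space_distr) measurable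
    have [measurable_cong]: "sets P0 = sets borel" unfolding law[of 0, symmetric] by simp
    have diag [measurable]: "{x::'x\<times>'x. fst x = snd x} \<in> sets (borel \<Otimes>\<^sub>M borel)"
    proof -
      have "{x::'x\<times>'x. fst x = snd x} = {x \<in> space (borel \<Otimes>\<^sub>M borel). dist (fst x) (snd x) = 0}"
        by (auto simp: space_pair_measure)
      also have "\<dots> \<in> sets (borel \<Otimes>\<^sub>M borel)" by measurable
      finally show ?thesis .
    qed
    have joint: "distr M (borel \<Otimes>\<^sub>M borel) (\<lambda>\<omega>. (z i \<omega>, z j \<omega>)) = P0 \<Otimes>\<^sub>M P0"
      using distr_indep_rv[OF indep_rv_of_indep_vars[OF z _ _ that]] law by simp
    have "emeasure M {\<omega> \<in> space M. z i \<omega> = z j \<omega>} =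
        emeasure (distr M (borel \<Otimes>\<^sub>M borel) (\<lambda>\<omega>. (z i \<omega>, z j \<omega>))) {x. fst x = snd x}"
      by (subst emeasure_distr) (auto intro!: arg_cong[where f = "emeasure M"])
    also have "\<dots> = (\<integral>\<^sup>+x. emeasure P0 (Pair x -` {x. fst x = snd x}) \<partial>P0)"
      unfolding joint by (rule P0.emeasure_pair_measure_alt) measurable
    also have "\<dots> = (\<integral>\<^sup>+x. 0 \<partial>P0)"
    proof (intro nn_integral_cong)
      fix x :: 'x
      have "Pair x -` {x. fst x = snd x} = {x}" by auto
      then show "emeasure P0 (Pair x -` {x. fst x = snd x}) = 0" by (simp add: nonatomic)
    qed
    finally have "emeasure M {\<omega> \<in> space M. z i \<omega> = z j \<omega>} = 0" by simp
    moreover have "{\<omega> \<in> space M. z i \<omega> = z j \<omega>} \<in> sets M"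
    proof -
      have "{\<omega> \<in> space M. z i \<omega> = z j \<omega>} = {\<omega> \<in> space M. dist (z i \<omega>) (z j \<omega>) = 0}" by auto
      also have "\<dots> \<in> sets M" by measurable
      finally show ?thesis .
    qed
    ultimately show ?thesis by (auto simp: AE_iff_null null_setsI)
  qed
  then have "AE \<omega> in M. \<forall>i j. i \<noteq> j \<longrightarrow> z i \<omega> \<noteq> z j \<omega>"
    by (simp add: AE_all_countable)
  then show ?thesis by eventually_elim (auto simp: inj_def)
qed

section \<open>Binary divergence and summation by parts\<close>

lemma binary_div_nonneg:
  assumes "0 < x" "x < 1" "0 < y" "y < 1"
  shows "0 \<le> binary_div x y"
proof -
  have *: "s - t \<le> s * ln (s / t)" if "0 < s" "0 < t" for s t :: real
  proof -
    have "ln (t / s) \<le> t / s - 1" using that by (intro ln_le_minus_one) simp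
    then have "s * (1 - t / s) \<le> s * ln (s / t)"
      using that by (intro mult_left_mono) (simp_all add: ln_div)
    then show ?thesis using that by (simp add: right_diff_distrib)
  qed
  show ?thesis
    using *[of x y] *[of "1 - x" "1 - y"] assms by (simp add: binary_div_def)
qed

text \<open>
  The entropy parts \<open>x ln x\<close> and \<open>(1 - x) ln (1 - x)\<close> are negative and the coefficients of
  \<open>- ln y\<close> and \<open>- ln (1 - y)\<close> are at most one.  The resulting bound is uniform in \<open>x\<close> and has moments
  of all orders when \<open>y\<close> is beta distributed.
\<close>
lemma binary_div_le:
  assumes "0 < x" "x < 1" "0 < y" "y < 1"
  shows "binary_div x y \<le> - ln y - ln (1 - y)"
proof -
  have *: "s * ln (s / t) \<le> - ln t" if "0 < s" "s < 1" "0 < t" "t < 1" for s t :: real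
  proof -
    have "s * ln s \<le> 0" using that by (intro mult_nonneg_nonpos) auto
    moreover have "s * (- ln t) \<le> 1 * (- ln t)" using that by (intro mult_right_mono) auto
    moreover have "s * ln (s / t) = s * ln s + s * (- ln t)"
      using that by (simp add: ln_div algebra_simps)
    ultimately show ?thesis by linarith
  qed
  show ?thesis
    using *[of x y] *[of "1 - x" "1 - y"] assms by (simp add: binary_div_def)
qed

lemma binary_div_expand:
  assumes "0 < x" "x < 1" "0 < y" "y < 1"
  shows "binary_div x y = x * ln x + (1 - x) * ln (1 - x) - x * ln y - (1 - x) * ln (1 - y)"
  using assms by (simp add: binary_div_def ln_div algebra_simps)

text \<open>
  Summation by parts.  The boundary term is the mass \<open>R\<^sub>N\<close> not yet assigned, times the logarithm of
  the ratio \<open>R\<^sub>N / (1 - y)\<^sup>N\<close> of the two unassigned masses.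
\<close>
lemma kl_partial_sum:
  fixes x :: "nat \<Rightarrow> real"
  assumes x: "\<And>n. 0 < x n \<and> x n < 1" and y: "0 < y" "y < 1"
  shows "(\<Sum>n<N. stick_weight x n * ln (stick_weight x n / geometric_weight y n)) =
    (\<Sum>n<N. (\<Prod>j<n. 1 - x j) * binary_div (x n) y)
      - (\<Prod>j<N. 1 - x j) * (ln (\<Prod>j<N. 1 - x j) - real N * ln (1 - y))"
proof (induction N)
  case (Suc N)
  define S where "S = (\<Prod>j<N. 1 - x j)"
  have S: "0 < S" unfolding S_def by (intro prod_pos) (use x in auto)
  have xN: "0 < x N" "x N < 1" using x by auto
  define L where "L = ln S"
  have weights: "stick_weight x N = x N * S" "geometric_weight y N = y * (1 - y) ^ N"
    by (simp_all add: stick_weight_def geometric_weight_def S_def)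
  have prod: "(\<Prod>j<Suc N. 1 - x j) = S * (1 - x N)"
    by (simp add: S_def)
  have ln_ratio: "ln (x N * S / (y * (1 - y) ^ N)) = ln (x N) + L - ln y - real N * ln (1 - y)"
    using S xN y by (simp add: L_def ln_div ln_mult ln_realpow)
  have ln_last: "ln (S * (1 - x N)) = L + ln (1 - x N)"
    using S xN by (simp add: L_def ln_mult)
  show ?case
    unfolding sum.lessThan_Suc prod weights ln_ratio ln_last Suc.IH S_def[symmetric] L_def[symmetric]
      binary_div_expand[OF xN y]
    by (simp add: algebra_simps)
qed simp

text \<open>
  The boundary term of the summation by parts is \<open>R\<^sub>N ln R\<^sub>N - N R\<^sub>N ln (1 - y)\<close>; it vanishes
  as soon as \<open>N R\<^sub>N\<close> does.
\<close>
lemma kl_sums: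
  fixes x :: "nat \<Rightarrow> real"
  assumes x: "\<And>n. 0 < x n \<and> x n < 1" and y: "0 < y" "y < 1"
    and sum: "summable (\<lambda>n. (\<Prod>j<n. 1 - x j) * binary_div (x n) y)"
    and lim: "(\<lambda>n. real n * (\<Prod>j<n. 1 - x j)) \<longlonglongrightarrow> 0"
  shows "(\<lambda>n. stick_weight x n * ln (stick_weight x n / geometric_weight y n)) sums
    (\<Sum>n. (\<Prod>j<n. 1 - x j) * binary_div (x n) y)"
proof -
  define S where "S n = (\<Prod>j<n. 1 - x j)" for n
  have S: "0 < S n" for n unfolding S_def by (intro prod_pos) (use x in auto)
  have nS: "(\<lambda>n. real n * S n) \<longlonglongrightarrow> 0" using lim by (simp add: S_def)
  have S0: "S \<longlonglongrightarrow> 0"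
  proof (rule tendsto_sandwich[OF _ _ tendsto_const nS])
    show "\<forall>\<^sub>F n in sequentially. 0 \<le> S n" using S by (simp add: less_imp_le)
    show "\<forall>\<^sub>F n in sequentially. S n \<le> real n * S n"
      using eventually_gt_at_top[of 0] by eventually_elim (use S in \<open>simp add: less_imp_le\<close>)
  qed
  have "(\<lambda>n. S n * ln (S n)) \<longlonglongrightarrow> 0"
  proof (rule Lim_null_comparison)
    show "(\<lambda>n. 2 * S n powr (1 / 2)) \<longlonglongrightarrow> 0"
      using tendsto_mult_right_zero[OF tendsto_zero_powrI[OF S0 tendsto_const[of "1/2"]], of 2] S
      by (simp add: less_imp_le)
    show "\<forall>\<^sub>F n in sequentially. norm (S n * ln (S n)) \<le> 2 * S n powr (1 / 2)"
    proof (rule always_eventually, rule allI)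
      fix n
      \<comment> \<open>\<open>\<bar>ln S\<bar> \<le> 2 / sqrt S\<close> on \<open>(0, 1]\<close>\<close>
    have "S n \<le> 1" unfolding S_def by (intro prod_le_1) (use x in \<open>auto simp: less_imp_le\<close>)
      then have "S n * \<bar>ln (S n)\<bar> \<le> S n * (S n powr (- (1 / 2)) / (1 / 2))"
        using S[of n] by (intro mult_left_mono abs_ln_le_powr) auto
      also have "\<dots> = 2 * S n powr (1 / 2)"
        using S[of n] by (simp add: powr_minus powr_half_sqrt real_div_sqrt field_simps)
      finally show "norm (S n * ln (S n)) \<le> 2 * S n powr (1 / 2)"
        using S[of n] by (simp add: abs_mult)
    qed
  qed
  moreover have "(\<lambda>n. real n * S n * ln (1 - y)) \<longlonglongrightarrow> 0 * ln (1 - y)"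
    by (intro tendsto_intros nS)
  ultimately have "(\<lambda>n. S n * ln (S n) - real n * S n * ln (1 - y)) \<longlonglongrightarrow> 0 - 0 * ln (1 - y)"
    by (rule tendsto_diff)
  then have "(\<lambda>n. S n * (ln (S n) - real n * ln (1 - y))) \<longlonglongrightarrow> 0"
    by (simp add: algebra_simps)
  moreover have "(\<lambda>N. \<Sum>n<N. S n * binary_div (x n) y) \<longlonglongrightarrow> (\<Sum>n. S n * binary_div (x n) y)"
    using summable_LIMSEQ[OF sum] by (simp add: S_def)
  ultimately have "(\<lambda>N. (\<Sum>n<N. S n * binary_div (x n) y) - S N * (ln (S N) - real N * ln (1 - y)))
      \<longlonglongrightarrow> (\<Sum>n. S n * binary_div (x n) y) - 0"
    by (rule tendsto_diff[rotated])
  then show ?thesis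
    unfolding sums_def kl_partial_sum[OF x y] by (simp add: S_def)
qed

section \<open>Finite products and double series\<close>

text \<open>
  Grouping the double sum by the larger index keeps the inner sums finite, so that only one limit
  remains to be exchanged with an expectation.
\<close>
lemma square_suminf:
  fixes t :: "nat \<Rightarrow> real"
  assumes t: "\<And>n. 0 \<le> t n" and sum: "summable t"
  shows "ennreal ((suminf t)\<^sup>2) = (\<Sum>n. ennreal ((t n)\<^sup>2) + 2 * (\<Sum>m<n. ennreal (t m * t n)))"
proof -
  have partial: "(\<Sum>n<N. t n)\<^sup>2 = (\<Sum>n<N. (t n)\<^sup>2 + 2 * (\<Sum>m<n. t m * t n))" for N
    by (induction N) (simp_all add: power2_sum sum_distrib_left sum_distrib_right algebra_simps)
  have "(\<lambda>N. (\<Sum>n<N. t n)\<^sup>2) \<longlonglongrightarrow> (suminf t)\<^sup>2"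
    by (intro tendsto_intros summable_LIMSEQ sum)
  then have "(\<lambda>n. (t n)\<^sup>2 + 2 * (\<Sum>m<n. t m * t n)) sums (suminf t)\<^sup>2"
    unfolding partial sums_def .
  then have "(\<Sum>n. ennreal ((t n)\<^sup>2 + 2 * (\<Sum>m<n. t m * t n))) = ennreal ((suminf t)\<^sup>2)"
    by (intro suminf_ennreal_eq) (use t in \<open>auto intro!: add_nonneg_nonneg sum_nonneg\<close>)
  moreover have "ennreal ((t n)\<^sup>2 + 2 * (\<Sum>m<n. t m * t n)) =
      ennreal ((t n)\<^sup>2) + 2 * (\<Sum>m<n. ennreal (t m * t n))" for n
    using t by (subst ennreal_plus) (auto simp: ennreal_mult sum_nonneg simp flip: sum_ennreal)
  ultimately show ?thesis by simp
qed

lemma prod_split_at_two: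
  fixes f :: "nat \<Rightarrow> 'c::comm_monoid_mult"
  assumes "m < n"
  shows "prod f {..n} = prod f {..<m} * f m * prod f {m<..<n} * f n"
proof -
  have "{..n} = insert n (insert m ({..<m} \<union> {m<..<n}))" using assms by auto
  moreover have "{..<m} \<inter> {m<..<n} = {}" by auto
  ultimately show ?thesis
    using assms by (simp add: prod.union_disjoint mult_ac)
qed

text \<open>
  A Cauchy product of geometric series, shifted by one because the inner sum is empty for \<open>n = 0\<close>.
\<close>
lemma sums_geometric_convolution:
  fixes q r :: real
  assumes q: "0 \<le> q" "q < 1" and r: "0 \<le> r" "r < 1"
  shows "(\<lambda>n. \<Sum>m<n. r ^ m * q ^ (n - Suc m)) sums (1 / ((1 - r) * (1 - q)))"
proof -
  have "(\<lambda>n. \<Sum>m\<le>n. r ^ m * q ^ (n - m)) sums ((\<Sum>n. r ^ n) * (\<Sum>n. q ^ n))"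
    using q r by (intro Cauchy_product_sums) (auto intro: summable_geometric)
  then have "(\<lambda>n. \<Sum>m<Suc n. r ^ m * q ^ (Suc n - Suc m)) sums (1 / ((1 - r) * (1 - q)))"
    using q r by (simp add: suminf_geometric lessThan_Suc_atMost)
  then show ?thesis by (subst (asm) sums_Suc_iff) simp
qed

section \<open>Moments of the divergence of a stick-breaking sequence\<close>

text \<open>
  The joint law of the sticks and of the parameter of the geometric process.  The locations serve
  only to identify the divergence with the series \<open>KL\<close>, whose moments are a matter of \<open>V\<close> and \<open>v\<close>.
\<close>
locale stick_breaking = prob_space M for M :: "'w measure" +
  fixes \<theta> a b :: real and V :: "nat \<Rightarrow> 'w \<Rightarrow> real" and v :: "'w \<Rightarrow> real"
  assumes \<theta>_pos: "0 < \<theta>" and a_pos: "0 < a" and b_pos: "0 < b"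
    and V_distr: "\<And>n. distributed M lborel (V n) (\<lambda>x. ennreal (beta_density 1 \<theta> x))"
    and V_indep: "indep_vars (\<lambda>_. borel) V UNIV"
    and v_distr: "distributed M lborel v (\<lambda>x. ennreal (beta_density a b x))"
    and v_indep: "indep_rv borel v (\<Pi>\<^sub>M n\<in>UNIV. borel) (\<lambda>\<omega> n. V n \<omega>)"
begin

definition rest :: "nat \<Rightarrow> 'w \<Rightarrow> real" where
  "rest n \<omega> = (\<Prod>j<n. 1 - V j \<omega>)"

definition stick_div :: "nat \<Rightarrow> 'w \<Rightarrow> real" where
  "stick_div n \<omega> = binary_div (V n \<omega>) (v \<omega>)"

definition KL :: "'w \<Rightarrow> real" where
  "KL \<omega> = kl_series (stick_weight (\<lambda>n. V n \<omega>)) (geometric_weight (v \<omega>))"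

lemma V_measurable [measurable]: "V n \<in> borel_measurable M"
  using distributed_measurable[OF V_distr] by simp

lemma v_measurable [measurable]: "v \<in> borel_measurable M"
  using distributed_measurable[OF v_distr] by simp

lemma binary_div_measurable [measurable]:
  assumes [measurable]: "f \<in> borel_measurable N" "g \<in> borel_measurable N"
  shows "(\<lambda>x. binary_div (f x) (g x)) \<in> borel_measurable N"
  unfolding binary_div_def by measurable

lemma rest_measurable [measurable]: "rest n \<in> borel_measurable M"
  unfolding rest_def by measurable

lemma stick_div_measurable [measurable]: "stick_div n \<in> borel_measurable M"
  unfolding stick_div_def by measurable

lemma KL_measurable [measurable]: "KL \<in> borel_measurable M"
  unfolding KL_def kl_series_def stick_weight_def geometric_weight_def by measurable

lemma AE_unit: "AE \<omega> in M. (\<forall>n. 0 < V n \<omega> \<and> V n \<omega> < 1) \<and> 0 < v \<omega> \<and> v \<omega> < 1"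
proof -
  have "AE \<omega> in M. \<forall>n. 0 < V n \<omega> \<and> V n \<omega> < 1"
    unfolding AE_all_countable
    by (intro allI beta_rv_in_unit[OF V_distr]) (use \<theta>_pos prob_space_axioms in auto)
  moreover have "AE \<omega> in M. 0 < v \<omega> \<and> v \<omega> < 1"
    by (rule beta_rv_in_unit[OF v_distr a_pos b_pos prob_space_axioms])
  ultimately show ?thesis by eventually_elim simp
qed

lemma AE_terms_nonneg: "AE \<omega> in M. \<forall>n. 0 \<le> rest n \<omega> \<and> 0 \<le> stick_div n \<omega>"
  using AE_unit
  by eventually_elim (auto simp: rest_def stick_div_def less_imp_le intro!: prod_nonneg binary_div_nonneg)

lemma nn_integral_V_eq:
  assumes "\<phi> \<in> borel_measurable borel"
  shows "(\<integral>\<^sup>+\<omega>. \<phi> (V n \<omega>) \<partial>M) = (\<integral>\<^sup>+\<omega>. \<phi> (V 0 \<omega>) \<partial>M)"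
  using distributed_nn_integral[OF V_distr, of \<phi> n] distributed_nn_integral[OF V_distr, of \<phi> 0] assms
  by simp

text \<open>
  The only form in which independence enters the moments: given \<open>v\<close>, the sticks are independent
  copies of \<open>V 0\<close>.  The terms of the series, and the products of two of them, factor into functions
  of \<open>v\<close> and one stick each.
\<close>
lemma nn_integral_conditionally_iid:
  assumes J: "finite J" and \<phi>: "\<And>j. case_prod (\<phi> j) \<in> borel_measurable (borel \<Otimes>\<^sub>M borel)"
  shows "(\<integral>\<^sup>+\<omega>. (\<Prod>j\<in>J. \<phi> j (v \<omega>) (V j \<omega>)) \<partial>M) =
    (\<integral>\<^sup>+\<omega>'. (\<Prod>j\<in>J. \<integral>\<^sup>+\<omega>. \<phi> j (v \<omega>') (V 0 \<omega>) \<partial>M) \<partial>M)"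
proof -
  \<comment> \<open>joint measurability in a form that applies to arbitrary compositions\<close>
  have [measurable]: "(\<lambda>x. \<phi> j (f x) (g x)) \<in> borel_measurable N"
    if "f \<in> borel_measurable N" "g \<in> borel_measurable N" for f g j and N :: "'z measure"
    using measurable_compose[OF measurable_Pair[OF that] \<phi>[of j]] by simp
  let ?f = "\<lambda>(y, x). \<Prod>j\<in>J. \<phi> j y (x j :: real)"
  have "(\<integral>\<^sup>+\<omega>. (\<Prod>j\<in>J. \<phi> j (v \<omega>) (V j \<omega>)) \<partial>M) = (\<integral>\<^sup>+\<omega>. ?f (v \<omega>, (\<lambda>n. V n \<omega>)) \<partial>M)"
    by simp
  also have "\<dots> = (\<integral>\<^sup>+\<omega>'. \<integral>\<^sup>+\<omega>. ?f (v \<omega>', (\<lambda>n. V n \<omega>)) \<partial>M \<partial>M)"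
    by (rule nn_integral_indep_rv[OF v_indep]) measurable
  also have "\<dots> = (\<integral>\<^sup>+\<omega>'. (\<Prod>j\<in>J. \<integral>\<^sup>+\<omega>. \<phi> j (v \<omega>') (V 0 \<omega>) \<partial>M) \<partial>M)"
  proof (rule nn_integral_cong)
    fix \<omega>'
    have "indep_vars (\<lambda>_. borel) (\<lambda>j \<omega>. \<phi> j (v \<omega>') (V j \<omega>)) J"
      by (rule indep_vars_compose2[OF indep_vars_subset[OF V_indep]]) auto
    then have "(\<integral>\<^sup>+\<omega>. (\<Prod>j\<in>J. \<phi> j (v \<omega>') (V j \<omega>)) \<partial>M) = (\<Prod>j\<in>J. \<integral>\<^sup>+\<omega>. \<phi> j (v \<omega>') (V j \<omega>) \<partial>M)"
      using J by (intro indep_vars_nn_integral) auto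
    also have "\<dots> = (\<Prod>j\<in>J. \<integral>\<^sup>+\<omega>. \<phi> j (v \<omega>') (V 0 \<omega>) \<partial>M)"
      by (intro prod.cong refl nn_integral_V_eq) measurable
    finally show "(\<integral>\<^sup>+\<omega>. ?f (v \<omega>', (\<lambda>n. V n \<omega>)) \<partial>M) = (\<Prod>j\<in>J. \<integral>\<^sup>+\<omega>. \<phi> j (v \<omega>') (V 0 \<omega>) \<partial>M)"
      by simp
  qed
  finally show ?thesis .
qed

lemma nn_integral_compl: "(\<integral>\<^sup>+\<omega>. ennreal (1 - V 0 \<omega>) \<partial>M) = ennreal (\<theta> / (\<theta> + 1))"
proof -
  have "has_bochner_integral M (\<lambda>\<omega>. 1 - V 0 \<omega>) (\<theta> / (\<theta> + 1))"
    using beta_rv_compl[OF V_distr _ \<theta>_pos] by (simp add: add.commute)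
  then show ?thesis
    using AE_unit by (subst nn_integral_eq_integral) (auto simp: has_bochner_integral_iff less_imp_le)
qed

lemma nn_integral_compl_sq: "(\<integral>\<^sup>+\<omega>. ennreal ((1 - V 0 \<omega>)\<^sup>2) \<partial>M) = ennreal (\<theta> / (\<theta> + 2))"
proof -
  have "\<theta> * (\<theta> + 1) / ((1 + \<theta>) * (1 + \<theta> + 1)) = \<theta> / (\<theta> + 2)"
    using \<theta>_pos by (simp add: divide_simps) (simp add: algebra_simps)
  then have "has_bochner_integral M (\<lambda>\<omega>. (1 - V 0 \<omega>)\<^sup>2) (\<theta> / (\<theta> + 2))"
    using beta_rv_compl_sq[OF V_distr _ \<theta>_pos, of 0] by simp
  then show ?thesis
    by (subst nn_integral_eq_integral) (auto simp: has_bochner_integral_iff)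
qed

lemma nn_integral_rest: "(\<integral>\<^sup>+\<omega>. ennreal (rest n \<omega>) \<partial>M) = ennreal (\<theta> / (\<theta> + 1)) ^ n"
proof -
  have "(\<integral>\<^sup>+\<omega>. ennreal (rest n \<omega>) \<partial>M) = (\<integral>\<^sup>+\<omega>. (\<Prod>j<n. ennreal (1 - V j \<omega>)) \<partial>M)"
    by (intro nn_integral_cong_AE, use AE_unit in eventually_elim)
      (simp add: rest_def prod_ennreal less_imp_le)
  also have "\<dots> = ennreal (\<theta> / (\<theta> + 1)) ^ n"
    using nn_integral_conditionally_iid[of "{..<n}" "\<lambda>_ _ x. ennreal (1 - x)"]
    by (simp add: nn_integral_compl emeasure_space_1)
  finally show ?thesis .
qed

text \<open>
  Given \<open>v\<close>, each of the first \<open>n\<close> sticks contributes the same constant, and only the stick \<open>n\<close> is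
  coupled to \<open>v\<close>.  The integral over \<open>v\<close> of its contribution need not be computed: it is the case
  \<open>n = 0\<close> of the same identity.
\<close>
lemma nn_integral_term_power:
  "(\<integral>\<^sup>+\<omega>. ennreal ((rest n \<omega> * stick_div n \<omega>) ^ k) \<partial>M) =
     (\<integral>\<^sup>+\<omega>. ennreal ((1 - V 0 \<omega>) ^ k) \<partial>M) ^ n * (\<integral>\<^sup>+\<omega>. ennreal (stick_div 0 \<omega> ^ k) \<partial>M)"
proof -
  let ?m = "\<integral>\<^sup>+\<omega>. ennreal ((1 - V 0 \<omega>) ^ k) \<partial>M"
  let ?g = "\<lambda>y. \<integral>\<^sup>+\<omega>. ennreal (binary_div (V 0 \<omega>) y ^ k) \<partial>M"
  have *: "(\<integral>\<^sup>+\<omega>. ennreal ((rest n \<omega> * stick_div n \<omega>) ^ k) \<partial>M) = ?m ^ n * (\<integral>\<^sup>+\<omega>. ?g (v \<omega>) \<partial>M)" for n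
  proof -
    define \<phi> where "\<phi> j y x = (if j < n then ennreal ((1 - x) ^ k) else ennreal (binary_div x y ^ k))"
      for j :: nat and y x
    have \<phi>: "case_prod (\<phi> j) \<in> borel_measurable (borel \<Otimes>\<^sub>M borel)" for j
      unfolding \<phi>_def by (cases "j < n") simp_all
    have "(\<integral>\<^sup>+\<omega>. ennreal ((rest n \<omega> * stick_div n \<omega>) ^ k) \<partial>M) = (\<integral>\<^sup>+\<omega>. (\<Prod>j<Suc n. \<phi> j (v \<omega>) (V j \<omega>)) \<partial>M)"
      using AE_unit AE_terms_nonneg
      by (intro nn_integral_cong_AE, eventually_elim)
        (simp add: \<phi>_def rest_def stick_div_def prod_ennreal power_mult_distrib less_imp_le
          prod_power_distrib ennreal_mult prod_nonneg)
    also have "\<dots> = (\<integral>\<^sup>+\<omega>'. (\<Prod>j<Suc n. \<integral>\<^sup>+\<omega>. \<phi> j (v \<omega>') (V 0 \<omega>) \<partial>M) \<partial>M)"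
      by (rule nn_integral_conditionally_iid) (use \<phi> in simp_all)
    also have "\<dots> = (\<integral>\<^sup>+\<omega>'. ?m ^ n * ?g (v \<omega>') \<partial>M)"
      by (simp add: \<phi>_def)
    also have "\<dots> = ?m ^ n * (\<integral>\<^sup>+\<omega>. ?g (v \<omega>) \<partial>M)"
      by (rule nn_integral_cmult) measurable
    finally show ?thesis .
  qed
  \<comment> \<open>the case \<open>n = 0\<close> evaluates the integral over \<open>v\<close>\<close>
  show ?thesis using *[of n] *[of 0] by (simp add: rest_def)
qed

text \<open>
  The sticks before \<open>m\<close> occur in both \<open>rest m\<close> and \<open>rest n\<close> and contribute second moments, those
  strictly between \<open>m\<close> and \<open>n\<close> first moments, and the stick \<open>m\<close> the factor \<open>1 - V m\<close> that stays
  coupled to its divergence.  The case \<open>m = 0\<close>, \<open>n = 1\<close> identifies the remaining expectation.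
\<close>
lemma nn_integral_cross_term:
  assumes "m < n"
  shows "(\<integral>\<^sup>+\<omega>. ennreal (rest m \<omega> * stick_div m \<omega> * (rest n \<omega> * stick_div n \<omega>)) \<partial>M) =
    ennreal (\<theta> / (\<theta> + 2)) ^ m * ennreal (\<theta> / (\<theta> + 1)) ^ (n - Suc m) *
      (\<integral>\<^sup>+\<omega>. ennreal ((1 - V 0 \<omega>) * stick_div 0 \<omega> * stick_div 1 \<omega>) \<partial>M)"
proof -
  let ?r = "ennreal (\<theta> / (\<theta> + 2))" and ?q = "ennreal (\<theta> / (\<theta> + 1))"
  let ?h = "\<lambda>y. \<integral>\<^sup>+\<omega>. ennreal ((1 - V 0 \<omega>) * binary_div (V 0 \<omega>) y) \<partial>M"
  let ?g = "\<lambda>y. \<integral>\<^sup>+\<omega>. ennreal (binary_div (V 0 \<omega>) y) \<partial>M"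
  \<comment> \<open>stated for all pairs of indices, since the pair \<open>(0, 1)\<close> is compared with \<open>(m, n)\<close> at the end\<close>
  have *: "(\<integral>\<^sup>+\<omega>. ennreal (rest m \<omega> * stick_div m \<omega> * (rest n \<omega> * stick_div n \<omega>)) \<partial>M) =
      ?r ^ m * ?q ^ (n - Suc m) * (\<integral>\<^sup>+\<omega>. ?h (v \<omega>) * ?g (v \<omega>) \<partial>M)" if mn: "m < n" for m n
  proof -
    define \<phi> where "\<phi> j y x =
        (if j < m then ennreal ((1 - x)\<^sup>2) else if j = m then ennreal ((1 - x) * binary_div x y)
         else if j < n then ennreal (1 - x) else ennreal (binary_div x y))" for j :: nat and y x
    have \<phi>: "case_prod (\<phi> j) \<in> borel_measurable (borel \<Otimes>\<^sub>M borel)" for j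
      unfolding \<phi>_def by (cases "j < m"; cases "j = m"; cases "j < n") simp_all
    have "(\<integral>\<^sup>+\<omega>. ennreal (rest m \<omega> * stick_div m \<omega> * (rest n \<omega> * stick_div n \<omega>)) \<partial>M) =
        (\<integral>\<^sup>+\<omega>. (\<Prod>j\<le>n. \<phi> j (v \<omega>) (V j \<omega>)) \<partial>M)"
    proof (intro nn_integral_cong_AE, use AE_unit AE_terms_nonneg in eventually_elim)
      case (elim \<omega>)
      let ?B = "\<Prod>j\<in>{m<..<n}. 1 - V j \<omega>"
      have nn: "0 \<le> 1 - V j \<omega>" "0 \<le> stick_div j \<omega>" "0 \<le> ?B" "0 \<le> rest j \<omega>" for j
        using elim by (auto simp: less_imp_le intro!: prod_nonneg)
      have "{..<n} = insert m ({..<m} \<union> {m<..<n})" "{..<m} \<inter> {m<..<n} = {}" using mn by auto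
      then have rest_n: "rest n \<omega> = rest m \<omega> * (1 - V m \<omega>) * ?B"
        by (simp add: rest_def prod.union_disjoint)
      have "(\<Prod>j<m. \<phi> j (v \<omega>) (V j \<omega>)) = ennreal ((rest m \<omega>)\<^sup>2)"
        by (simp add: \<phi>_def prod_ennreal rest_def prod_power_distrib)
      moreover have "(\<Prod>j\<in>{m<..<n}. \<phi> j (v \<omega>) (V j \<omega>)) = ennreal ?B"
        using nn(1) by (simp add: \<phi>_def prod_ennreal)
      moreover have "\<phi> m (v \<omega>) (V m \<omega>) = ennreal ((1 - V m \<omega>) * stick_div m \<omega>)"
        "\<phi> n (v \<omega>) (V n \<omega>) = ennreal (stick_div n \<omega>)"
        using mn by (simp_all add: \<phi>_def stick_div_def)
      ultimately have "(\<Prod>j\<le>n. \<phi> j (v \<omega>) (V j \<omega>)) =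
          ennreal ((rest m \<omega>)\<^sup>2 * ((1 - V m \<omega>) * stick_div m \<omega>) * ?B * stick_div n \<omega>)"
        using nn by (simp add: prod_split_at_two[OF mn] ennreal_mult)
      also have "(rest m \<omega>)\<^sup>2 * ((1 - V m \<omega>) * stick_div m \<omega>) * ?B * stick_div n \<omega> =
          rest m \<omega> * stick_div m \<omega> * (rest n \<omega> * stick_div n \<omega>)"
        by (simp add: rest_n power2_eq_square)
      finally show ?case by simp
    qed
    also have "\<dots> = (\<integral>\<^sup>+\<omega>'. (\<Prod>j\<le>n. \<integral>\<^sup>+\<omega>. \<phi> j (v \<omega>') (V 0 \<omega>) \<partial>M) \<partial>M)"
      by (rule nn_integral_conditionally_iid) (use \<phi> in simp_all)
    also have "\<dots> = (\<integral>\<^sup>+\<omega>'. ?r ^ m * ?q ^ (n - Suc m) * (?h (v \<omega>') * ?g (v \<omega>')) \<partial>M)"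
    proof (rule nn_integral_cong)
      fix \<omega>'
      have "(\<Prod>j<m. \<integral>\<^sup>+\<omega>. \<phi> j (v \<omega>') (V 0 \<omega>) \<partial>M) = ?r ^ m"
        by (simp add: \<phi>_def nn_integral_compl_sq)
      moreover have "(\<Prod>j\<in>{m<..<n}. \<integral>\<^sup>+\<omega>. \<phi> j (v \<omega>') (V 0 \<omega>) \<partial>M) = ?q ^ (n - Suc m)"
        by (simp add: \<phi>_def nn_integral_compl)
      ultimately show "(\<Prod>j\<le>n. \<integral>\<^sup>+\<omega>. \<phi> j (v \<omega>') (V 0 \<omega>) \<partial>M) =
          ?r ^ m * ?q ^ (n - Suc m) * (?h (v \<omega>') * ?g (v \<omega>'))"
        using mn by (simp add: prod_split_at_two[OF mn]) (simp add: \<phi>_def mult_ac)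
    qed
    also have "\<dots> = ?r ^ m * ?q ^ (n - Suc m) * (\<integral>\<^sup>+\<omega>. ?h (v \<omega>) * ?g (v \<omega>) \<partial>M)"
      by (rule nn_integral_cmult) measurable
    finally show ?thesis .
  qed
  show ?thesis
    using *[OF assms] *[of 0 1] by (simp add: rest_def mult_ac)
qed

lemma log_bound_sq: "integrable M (\<lambda>\<omega>. (ln (v \<omega>) + ln (1 - v \<omega>))\<^sup>2)"
proof (rule Bochner_Integration.integrable_bound)
  show "integrable M (\<lambda>\<omega>. 2 * (ln (v \<omega>))\<^sup>2 + 2 * (ln (1 - v \<omega>))\<^sup>2)"
    using beta_rv_ln_sq[OF v_distr a_pos b_pos] beta_rv_ln_compl_sq[OF v_distr a_pos b_pos] by simp
  have "(s + t)\<^sup>2 \<le> 2 * s\<^sup>2 + 2 * t\<^sup>2" for s t :: real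
    using zero_le_power2[of "s - t"] by (simp add: power2_eq_square algebra_simps)
  then show "AE \<omega> in M. norm ((ln (v \<omega>) + ln (1 - v \<omega>))\<^sup>2)
      \<le> norm (2 * (ln (v \<omega>))\<^sup>2 + 2 * (ln (1 - v \<omega>))\<^sup>2)" by simp
qed measurable

lemma AE_stick_div_bound: "AE \<omega> in M. \<forall>n. \<bar>stick_div n \<omega>\<bar> \<le> \<bar>ln (v \<omega>) + ln (1 - v \<omega>)\<bar>"
  using AE_unit AE_terms_nonneg
proof eventually_elim
  case (elim \<omega>)
  then have "stick_div n \<omega> \<le> - ln (v \<omega>) - ln (1 - v \<omega>)" for n
    unfolding stick_div_def by (intro binary_div_le) auto
  then show ?case using elim by (auto simp: abs_le_iff) (smt (verit))+
qed

lemma integrable_stick_div: "integrable M (stick_div n)"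
proof (rule Bochner_Integration.integrable_bound)
  show "integrable M (\<lambda>\<omega>. ln (v \<omega>) + ln (1 - v \<omega>))"
    using beta_rv_ln[OF v_distr a_pos b_pos] beta_rv_ln_compl[OF v_distr a_pos b_pos]
    by (simp add: has_bochner_integral_iff)
qed (use AE_stick_div_bound in auto)

lemma integrable_stick_div_sq: "integrable M (\<lambda>\<omega>. (stick_div n \<omega>)\<^sup>2)"
proof (rule Bochner_Integration.integrable_bound[OF log_bound_sq])
  show "AE \<omega> in M. norm ((stick_div n \<omega>)\<^sup>2) \<le> norm ((ln (v \<omega>) + ln (1 - v \<omega>))\<^sup>2)"
    using AE_stick_div_bound by eventually_elim (simp add: abs_le_square_iff)
qed measurable

lemma integrable_compl_div_div: "integrable M (\<lambda>\<omega>. (1 - V 0 \<omega>) * stick_div 0 \<omega> * stick_div 1 \<omega>)"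
proof (rule Bochner_Integration.integrable_bound[OF log_bound_sq])
  show "AE \<omega> in M. norm ((1 - V 0 \<omega>) * stick_div 0 \<omega> * stick_div 1 \<omega>) \<le> norm ((ln (v \<omega>) + ln (1 - v \<omega>))\<^sup>2)"
    using AE_stick_div_bound AE_unit
  proof eventually_elim
    case (elim \<omega>)
    let ?l = "\<bar>ln (v \<omega>) + ln (1 - v \<omega>)\<bar>"
    have "0 \<le> V 0 \<omega>" "V 0 \<omega> \<le> 1" using elim by (auto simp: less_imp_le)
    then have "\<bar>1 - V 0 \<omega>\<bar> * \<bar>stick_div 0 \<omega>\<bar> * \<bar>stick_div 1 \<omega>\<bar> \<le> 1 * ?l * ?l"
      using elim by (intro mult_mono) auto
    then show ?case by (simp add: abs_mult power2_eq_square)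
  qed
qed measurable

lemma nn_integral_stick_div: "(\<integral>\<^sup>+\<omega>. ennreal (stick_div 0 \<omega>) \<partial>M) = ennreal (expectation (stick_div 0))"
  using AE_terms_nonneg by (intro nn_integral_eq_integral integrable_stick_div) auto

text \<open>
  Both conditions for the summation by parts hold because series of nonnegative terms with
  summable expectations converge almost surely: \<open>E(R\<^sub>n d\<^sub>n) = q\<^sup>n E(d\<^sub>0)\<close> and
  \<open>E((n + 1) R\<^sub>n) = (n + 1) q\<^sup>n\<close>.
\<close>
lemma AE_KL_sums:
  "AE \<omega> in M. (\<lambda>n. rest n \<omega> * stick_div n \<omega>) sums KL \<omega> \<and>
    (\<lambda>n. stick_weight (\<lambda>n. V n \<omega>) n *
      ln (stick_weight (\<lambda>n. V n \<omega>) n / geometric_weight (v \<omega>) n)) sums KL \<omega>"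
proof -
  define q where "q = \<theta> / (\<theta> + 1)"
  have q: "0 \<le> q" "q < 1" using \<theta>_pos by (auto simp: q_def)
  have summable_AE: "AE \<omega> in M. summable (\<lambda>n. f n \<omega>)"
    if [measurable]: "\<And>n. f n \<in> borel_measurable M" and nonneg: "AE \<omega> in M. \<forall>n. 0 \<le> f n \<omega>"
      and int: "\<And>n. (\<integral>\<^sup>+\<omega>. ennreal (f n \<omega>) \<partial>M) = ennreal (c n)" and c: "\<And>n. 0 \<le> c n" "summable c"
    for f :: "nat \<Rightarrow> 'w \<Rightarrow> real" and c
  proof -
    have "(\<integral>\<^sup>+\<omega>. (\<Sum>n. ennreal (f n \<omega>)) \<partial>M) = (\<Sum>n. ennreal (c n))"
      by (simp add: nn_integral_suminf int)
    also have "\<dots> \<noteq> \<infinity>"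
      using ennreal_suminf_neq_top[OF c(2,1)] by simp
    finally have "AE \<omega> in M. (\<Sum>n. ennreal (f n \<omega>)) \<noteq> \<infinity>"
      by (intro nn_integral_PInf_AE) auto
    then show ?thesis
      using nonneg by eventually_elim (auto intro: summable_suminf_not_top)
  qed
  have "AE \<omega> in M. summable (\<lambda>n. rest n \<omega> * stick_div n \<omega>)"
  proof (rule summable_AE)
    show "(\<integral>\<^sup>+\<omega>. ennreal (rest n \<omega> * stick_div n \<omega>) \<partial>M) = ennreal (q ^ n * expectation (stick_div 0))" for n
      using nn_integral_term_power[of n 1] q
      by (simp add: nn_integral_compl nn_integral_stick_div q_def[symmetric] ennreal_mult' ennreal_power)
    show "summable (\<lambda>n. q ^ n * expectation (stick_div 0))"
      using q by (intro summable_mult2 summable_geometric) simp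
    show "0 \<le> q ^ n * expectation (stick_div 0)" for n
      using q AE_terms_nonneg by (intro mult_nonneg_nonneg integral_nonneg_AE) auto
  qed (use AE_terms_nonneg in auto)
  moreover have "AE \<omega> in M. summable (\<lambda>n. real (Suc n) * rest n \<omega>)"
  proof (rule summable_AE)
    show "(\<integral>\<^sup>+\<omega>. ennreal (real (Suc n) * rest n \<omega>) \<partial>M) = ennreal (real (Suc n) * q ^ n)" for n
      using AE_terms_nonneg q
      by (simp add: ennreal_mult' nn_integral_cmult nn_integral_rest q_def[symmetric] ennreal_power
          del: of_nat_Suc)
    show "summable (\<lambda>n. real (Suc n) * q ^ n)"
      using geometric_deriv_sums[of q] q by (simp add: sums_iff)
  qed (use AE_terms_nonneg q in \<open>auto simp del: of_nat_Suc\<close>)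
  ultimately show ?thesis
    using AE_unit AE_terms_nonneg
  proof eventually_elim
    case (elim \<omega>)
    have "(\<lambda>n. real n * rest n \<omega>) \<longlonglongrightarrow> 0"
    proof (rule Lim_null_comparison[OF _ summable_LIMSEQ_zero])
      show "summable (\<lambda>n. real (Suc n) * rest n \<omega>)" using elim by simp
      show "\<forall>\<^sub>F n in sequentially. norm (real n * rest n \<omega>) \<le> real (Suc n) * rest n \<omega>"
        using elim by (intro always_eventually allI) (auto simp: abs_mult intro!: mult_right_mono)
    qed
    then have "(\<lambda>n. stick_weight (\<lambda>n. V n \<omega>) n *
      ln (stick_weight (\<lambda>n. V n \<omega>) n / geometric_weight (v \<omega>) n)) sums (\<Sum>n. rest n \<omega> * stick_div n \<omega>)"
      unfolding rest_def stick_div_def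
      by (intro kl_sums) (use elim in \<open>auto simp: rest_def stick_div_def\<close>)
    then show ?case
      using elim by (auto simp: KL_def kl_series_def sums_iff)
  qed
qed

lemma has_bochner_integral_KL: "has_bochner_integral M KL ((\<theta> + 1) * expectation (stick_div 0))"
proof -
  define q where "q = \<theta> / (\<theta> + 1)"
  have q: "0 \<le> q" "q < 1" "1 / (1 - q) = \<theta> + 1" using \<theta>_pos by (auto simp: q_def field_simps)
  have E: "0 \<le> expectation (stick_div 0)"
    using AE_terms_nonneg by (intro integral_nonneg_AE) auto
  have "(\<integral>\<^sup>+\<omega>. ennreal (KL \<omega>) \<partial>M) = (\<integral>\<^sup>+\<omega>. (\<Sum>n. ennreal (rest n \<omega> * stick_div n \<omega>)) \<partial>M)"
    by (intro nn_integral_cong_AE, use AE_KL_sums AE_terms_nonneg in eventually_elim)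
      (auto intro!: suminf_ennreal_eq[symmetric])
  also have "\<dots> = (\<Sum>n. ennreal (q ^ n * expectation (stick_div 0)))"
    using nn_integral_term_power[of _ 1] E q
    by (simp add: nn_integral_suminf nn_integral_compl nn_integral_stick_div q_def[symmetric]
        ennreal_mult ennreal_power)
  also have "\<dots> = ennreal (1 / (1 - q) * expectation (stick_div 0))"
    using q E by (intro suminf_ennreal_eq sums_mult2 geometric_sums) auto
  finally have "(\<integral>\<^sup>+\<omega>. ennreal (KL \<omega>) \<partial>M) = ennreal ((\<theta> + 1) * expectation (stick_div 0))"
    by (simp only: q)
  moreover have "AE \<omega> in M. 0 \<le> KL \<omega>"
    using AE_KL_sums AE_terms_nonneg
  proof eventually_elim
    case (elim \<omega>)
    from elim have "(\<lambda>n. rest n \<omega> * stick_div n \<omega>) sums KL \<omega>" by simp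
    then show "0 \<le> KL \<omega>" by (rule sums_le[OF _ sums_zero, rotated]) (use elim in simp)
  qed
  ultimately show ?thesis
    using E \<theta>_pos by (intro has_bochner_integral_nn_integral) auto
qed

lemma has_bochner_integral_KL_sq:
  "has_bochner_integral M (\<lambda>\<omega>. (KL \<omega>)\<^sup>2)
    ((\<theta> + 1) * (\<theta> + 2) * expectation (\<lambda>\<omega>. (1 - V 0 \<omega>) * stick_div 0 \<omega> * stick_div 1 \<omega>) +
     (\<theta> + 2) / 2 * expectation (\<lambda>\<omega>. (stick_div 0 \<omega>)\<^sup>2))"
proof -
  define q where "q = \<theta> / (\<theta> + 1)"
  define r where "r = \<theta> / (\<theta> + 2)"
  define A where "A = expectation (\<lambda>\<omega>. (stick_div 0 \<omega>)\<^sup>2)"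
  define K where "K = expectation (\<lambda>\<omega>. (1 - V 0 \<omega>) * stick_div 0 \<omega> * stick_div 1 \<omega>)"
  have q: "0 \<le> q" "q < 1" and r: "0 \<le> r" "r < 1" using \<theta>_pos by (auto simp: q_def r_def)
  have inv: "1 / (1 - q) = \<theta> + 1" "1 / (1 - r) = (\<theta> + 2) / 2"
    using \<theta>_pos by (auto simp: q_def r_def field_simps)
  have K_nonneg: "AE \<omega> in M. 0 \<le> (1 - V 0 \<omega>) * stick_div 0 \<omega> * stick_div 1 \<omega>"
    using AE_terms_nonneg AE_unit by eventually_elim (simp add: less_imp_le)
  have A: "0 \<le> A" and K: "0 \<le> K"
    unfolding A_def K_def using K_nonneg by (auto intro: integral_nonneg_AE)
  have A_eq: "(\<integral>\<^sup>+\<omega>. ennreal ((stick_div 0 \<omega>)\<^sup>2) \<partial>M) = ennreal A"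
    unfolding A_def by (intro nn_integral_eq_integral integrable_stick_div_sq) simp
  have K_eq: "(\<integral>\<^sup>+\<omega>. ennreal ((1 - V 0 \<omega>) * stick_div 0 \<omega> * stick_div 1 \<omega>) \<partial>M) = ennreal K"
    unfolding K_def by (intro nn_integral_eq_integral integrable_compl_div_div K_nonneg)
  let ?t = "\<lambda>n \<omega>. rest n \<omega> * stick_div n \<omega>"
  have "(\<integral>\<^sup>+\<omega>. ennreal ((KL \<omega>)\<^sup>2) \<partial>M) =
      (\<integral>\<^sup>+\<omega>. (\<Sum>n. ennreal ((?t n \<omega>)\<^sup>2) + 2 * (\<Sum>m<n. ennreal (?t m \<omega> * ?t n \<omega>))) \<partial>M)"
  proof (intro nn_integral_cong_AE, use AE_KL_sums AE_terms_nonneg in eventually_elim)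
    case (elim \<omega>)
    then have "KL \<omega> = (\<Sum>n. ?t n \<omega>)" "summable (\<lambda>n. ?t n \<omega>)" by (auto simp: sums_iff)
    then show ?case using elim square_suminf[of "\<lambda>n. ?t n \<omega>"] by simp
  qed
  also have "\<dots> = (\<Sum>n. (\<integral>\<^sup>+\<omega>. ennreal ((?t n \<omega>)\<^sup>2) \<partial>M) +
      2 * (\<Sum>m<n. \<integral>\<^sup>+\<omega>. ennreal (?t m \<omega> * ?t n \<omega>) \<partial>M))"
    by (simp add: nn_integral_suminf nn_integral_add nn_integral_cmult nn_integral_sum)
  also have "\<dots> = (\<Sum>n. ennreal (r ^ n * A + 2 * (\<Sum>m<n. r ^ m * q ^ (n - Suc m)) * K))"
  proof (intro arg_cong[where f = suminf] ext)
    fix n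
    have "(\<Sum>m<n. \<integral>\<^sup>+\<omega>. ennreal (?t m \<omega> * ?t n \<omega>) \<partial>M) =
        (\<Sum>m<n. ennreal (r ^ m * q ^ (n - Suc m) * K))"
      using q r K
      by (intro sum.cong refl)
        (simp add: nn_integral_cross_term K_eq[unfolded One_nat_def] ennreal_mult ennreal_power q_def[symmetric] r_def[symmetric])
    also have "\<dots> = ennreal ((\<Sum>m<n. r ^ m * q ^ (n - Suc m)) * K)"
      using q r K by (simp add: sum_distrib_right sum_ennreal)
    finally show "(\<integral>\<^sup>+\<omega>. ennreal ((?t n \<omega>)\<^sup>2) \<partial>M) + 2 * (\<Sum>m<n. \<integral>\<^sup>+\<omega>. ennreal (?t m \<omega> * ?t n \<omega>) \<partial>M) =
        ennreal (r ^ n * A + 2 * (\<Sum>m<n. r ^ m * q ^ (n - Suc m)) * K)"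
      using q r A K
      by (simp add: nn_integral_term_power nn_integral_compl_sq A_eq r_def[symmetric]
          ennreal_mult ennreal_power sum_nonneg mult.assoc)
  qed
  also have "\<dots> = ennreal (1 / (1 - r) * A + 2 * (1 / ((1 - r) * (1 - q))) * K)"
    using q r A K
    by (intro suminf_ennreal_eq sums_add sums_mult sums_mult2 geometric_sums
        sums_geometric_convolution) (auto intro!: add_nonneg_nonneg mult_nonneg_nonneg sum_nonneg)
  also have "1 / (1 - r) * A + 2 * (1 / ((1 - r) * (1 - q))) * K =
      (\<theta> + 1) * (\<theta> + 2) * K + (\<theta> + 2) / 2 * A"
  proof -
    have "1 / ((1 - r) * (1 - q)) = (\<theta> + 2) / 2 * (\<theta> + 1)"
      unfolding inv[symmetric] by simp
    then show ?thesis unfolding inv(2) by (simp add: algebra_simps)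
  qed
  finally show ?thesis
    unfolding A_def[symmetric] K_def[symmetric]
    using A K \<theta>_pos by (intro has_bochner_integral_nn_integral) auto
qed

lemma variance_KL:
  "variance KL = (\<theta> + 1) * (\<theta> + 2) * expectation (\<lambda>\<omega>. (1 - V 0 \<omega>) * stick_div 0 \<omega> * stick_div 1 \<omega>) +
     (\<theta> + 2) / 2 * expectation (\<lambda>\<omega>. (stick_div 0 \<omega>)\<^sup>2) - ((\<theta> + 1) * expectation (stick_div 0))\<^sup>2"
  using has_bochner_integral_KL has_bochner_integral_KL_sq
  by (subst variance_eq) (auto simp: has_bochner_integral_iff)

text \<open>
  Independence of \<open>V 0\<close> and \<open>v\<close> for nonnegative functions, which covers the mixed terms
  \<open>- V 0 ln v\<close> and \<open>- (1 - V 0) ln (1 - v)\<close> of the binary divergence.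
\<close>
lemma has_bochner_integral_V_v_product:
  assumes f: "f \<in> borel_measurable borel" "\<And>x. 0 < x \<Longrightarrow> x < 1 \<Longrightarrow> 0 \<le> f x"
    and g: "g \<in> borel_measurable borel" "\<And>y. 0 < y \<Longrightarrow> y < 1 \<Longrightarrow> 0 \<le> g y"
    and int_f: "has_bochner_integral M (\<lambda>\<omega>. f (V 0 \<omega>)) \<alpha>"
    and int_g: "has_bochner_integral M (\<lambda>\<omega>. g (v \<omega>)) \<beta>"
  shows "has_bochner_integral M (\<lambda>\<omega>. f (V 0 \<omega>) * g (v \<omega>)) (\<alpha> * \<beta> :: real)"
proof (rule has_bochner_integral_nn_integral)
  note [measurable] = f(1) g(1)
  show "(\<lambda>\<omega>. f (V 0 \<omega>) * g (v \<omega>)) \<in> borel_measurable M"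
    by (intro borel_measurable_times measurable_compose[OF V_measurable f(1)]
        measurable_compose[OF v_measurable g(1)])
  have nonneg: "AE \<omega> in M. 0 \<le> f (V 0 \<omega>) \<and> 0 \<le> g (v \<omega>)"
    using AE_unit by eventually_elim (simp add: f(2) g(2))
  have \<alpha>: "(\<integral>\<^sup>+\<omega>. ennreal (f (V 0 \<omega>)) \<partial>M) = ennreal \<alpha>" "0 \<le> \<alpha>"
    using int_f nonneg nn_integral_eq_integral[of M "\<lambda>\<omega>. f (V 0 \<omega>)"]
      integral_nonneg_AE[of "\<lambda>\<omega>. f (V 0 \<omega>)" M] by (auto simp: has_bochner_integral_iff)
  have \<beta>: "(\<integral>\<^sup>+\<omega>. ennreal (g (v \<omega>)) \<partial>M) = ennreal \<beta>" "0 \<le> \<beta>"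
    using int_g nonneg nn_integral_eq_integral[of M "\<lambda>\<omega>. g (v \<omega>)"]
      integral_nonneg_AE[of "\<lambda>\<omega>. g (v \<omega>)" M] by (auto simp: has_bochner_integral_iff)
  show "0 \<le> \<alpha> * \<beta>" using \<alpha> \<beta> by simp
  show "AE \<omega> in M. 0 \<le> f (V 0 \<omega>) * g (v \<omega>)" using nonneg by eventually_elim simp
  have "(\<integral>\<^sup>+\<omega>. ennreal (f (V 0 \<omega>) * g (v \<omega>)) \<partial>M) =
      (\<integral>\<^sup>+\<omega>. ennreal (g (v \<omega>)) * ennreal (f (V 0 \<omega>)) \<partial>M)"
    using nonneg by (intro nn_integral_cong_AE, eventually_elim) (simp add: ennreal_mult mult.commute)
  also have "\<dots> = (\<integral>\<^sup>+\<omega>'. \<integral>\<^sup>+\<omega>. ennreal (g (v \<omega>')) * ennreal (f (V 0 \<omega>)) \<partial>M \<partial>M)"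
    using nn_integral_conditionally_iid[of "{0}" "\<lambda>_ y x. ennreal (g y) * ennreal (f x)"] by simp
  also have "\<dots> = ennreal (\<alpha> * \<beta>)"
    using \<alpha> \<beta> by (simp add: nn_integral_cmult nn_integral_multc ennreal_mult mult.commute)
  finally show "(\<integral>\<^sup>+\<omega>. ennreal (f (V 0 \<omega>) * g (v \<omega>)) \<partial>M) = ennreal (\<alpha> * \<beta>)" .
qed

text \<open>
  The four terms of the expanded binary divergence are, up to independence, logarithmic moments of
  beta distributions.  The factors \<open>V 0\<close> and \<open>1 - V 0\<close> shift the parameters, and
  \<open>\<psi>(\<theta> + 1) - \<psi>(\<theta> + 2) = - 1 / (\<theta> + 1)\<close> simplifies the term from \<open>(1 - V 0) ln (1 - V 0)\<close>.
\<close>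
lemma expectation_stick_div:
  "expectation (stick_div 0) =
     1 / (\<theta> + 1) * (Digamma 2 - Digamma (\<theta> + 2) - Digamma a + Digamma (a + b)) +
     \<theta> / (\<theta> + 1) * (- (1 / (\<theta> + 1)) - Digamma b + Digamma (a + b))"
proof -
  have compl: "has_bochner_integral M (\<lambda>\<omega>. 1 - V 0 \<omega>) (\<theta> / (\<theta> + 1))"
    using beta_rv_compl[OF V_distr _ \<theta>_pos] by (simp add: add.commute)
  have mean: "has_bochner_integral M (V 0) (1 / (\<theta> + 1))"
    using beta_rv_mean[OF V_distr _ \<theta>_pos, of 0] by (simp add: add.commute)
  have ln_v: "has_bochner_integral M (\<lambda>\<omega>. - ln (v \<omega>)) (- (Digamma a - Digamma (a + b)))"
    and ln_compl_v: "has_bochner_integral M (\<lambda>\<omega>. - ln (1 - v \<omega>)) (- (Digamma b - Digamma (a + b)))"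
    by (intro has_bochner_integral_minus beta_rv_ln[OF v_distr a_pos b_pos]
        beta_rv_ln_compl[OF v_distr a_pos b_pos])+
  have V_ln_v: "has_bochner_integral M (\<lambda>\<omega>. V 0 \<omega> * - ln (v \<omega>))
      (1 / (\<theta> + 1) * - (Digamma a - Digamma (a + b)))"
    by (rule has_bochner_integral_V_v_product[OF _ _ _ _ mean ln_v]) auto
  have compl_ln_v: "has_bochner_integral M (\<lambda>\<omega>. (1 - V 0 \<omega>) * - ln (1 - v \<omega>))
      (\<theta> / (\<theta> + 1) * - (Digamma b - Digamma (a + b)))"
    by (rule has_bochner_integral_V_v_product[where f = "\<lambda>x. 1 - x" and g = "\<lambda>y. - ln (1 - y)",
          OF _ _ _ _ compl ln_compl_v]) auto
  have V_ln_V: "has_bochner_integral M (\<lambda>\<omega>. V 0 \<omega> * ln (V 0 \<omega>))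
      (1 / (\<theta> + 1) * (Digamma 2 - Digamma (\<theta> + 2)))"
    using beta_rv_mult_ln[OF V_distr _ \<theta>_pos, of 0] by (simp add: add_ac)
  have "Digamma (\<theta> + 1) - Digamma (1 + \<theta> + 1) = - (1 / (\<theta> + 1))"
    using Digamma_plus1[of "\<theta> + 1"] \<theta>_pos by (simp add: add_ac)
  then have compl_ln_V: "has_bochner_integral M (\<lambda>\<omega>. (1 - V 0 \<omega>) * ln (1 - V 0 \<omega>))
      (\<theta> / (\<theta> + 1) * - (1 / (\<theta> + 1)))"
    using beta_rv_mult_ln_compl[OF V_distr _ \<theta>_pos, of 0] by (simp add: add.commute)
  let ?g = "\<lambda>\<omega>. V 0 \<omega> * ln (V 0 \<omega>) + (1 - V 0 \<omega>) * ln (1 - V 0 \<omega>) +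
    (V 0 \<omega> * - ln (v \<omega>) + (1 - V 0 \<omega>) * - ln (1 - v \<omega>))"
  have "expectation (stick_div 0) = expectation ?g"
  proof (rule integral_cong_AE)
    show "AE \<omega> in M. stick_div 0 \<omega> = ?g \<omega>"
      using AE_unit
      by eventually_elim (simp add: stick_div_def binary_div_expand)
  qed measurable
  also have "\<dots> = 1 / (\<theta> + 1) * (Digamma 2 - Digamma (\<theta> + 2)) + \<theta> / (\<theta> + 1) * - (1 / (\<theta> + 1)) +
      (1 / (\<theta> + 1) * - (Digamma a - Digamma (a + b)) + \<theta> / (\<theta> + 1) * - (Digamma b - Digamma (a + b)))"
    by (intro has_bochner_integral_integral_eq has_bochner_integral_add
        V_ln_V compl_ln_V V_ln_v compl_ln_v)
  finally show ?thesis
    by (simp only: ring_distribs diff_conv_add_uminus mult_minus_right add_ac minus_minus minus_add_distrib)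
qed

end

section \<open>The Dirichlet process against the geometric process\<close>

theorem lemma2:
  fixes M :: "'w measure"
    and P0 :: "'x::polish_space measure"
    and \<theta> a b \<rho> :: real
    and V :: "nat \<Rightarrow> 'w \<Rightarrow> real"
    and v :: "'w \<Rightarrow> real"
    and z :: "nat \<Rightarrow> 'w \<Rightarrow> 'x"
    and w w' :: "'w \<Rightarrow> nat \<Rightarrow> real"
    and P P' :: "'w \<Rightarrow> 'x measure"
    and D :: "'w \<Rightarrow> real"
  assumes M: "prob_space M"
    and pos: "\<theta> > 0" "a > 0" "b > 0"
    and rho: "\<rho> = 1 / (\<theta> + 1)"
    and V_distr: "\<And>n. distributed M lborel (V n) (\<lambda>x. ennreal (beta_density 1 \<theta> x))"
    and V_indep: "prob_space.indep_vars M (\<lambda>_. borel) V UNIV"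
    and v_distr: "distributed M lborel v (\<lambda>x. ennreal (beta_density a b x))"
    and v_indep: "prob_space.indep_rv M borel v (\<Pi>\<^sub>M n\<in>UNIV. borel) (\<lambda>\<omega> n. V n \<omega>)"
    and w: "\<And>\<omega>. w \<omega> = stick_weight (\<lambda>n. V n \<omega>)"
    and w': "\<And>\<omega>. w' \<omega> = geometric_weight (v \<omega>)"
    and P0: "prob_space P0" "sets P0 = sets borel"
    and P0_nonatomic: "\<And>x. emeasure P0 {x} = 0"
    and z_distr: "\<And>n. z n \<in> borel_measurable M" "\<And>n. distr M borel (z n) = P0"
    and z_indep: "prob_space.indep_vars M (\<lambda>_. borel) z UNIV"
    and z_weights_indep:
      "prob_space.indep_rv M (\<Pi>\<^sub>M n\<in>UNIV. borel) (\<lambda>\<omega> n. z n \<omega>)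
         ((\<Pi>\<^sub>M n\<in>UNIV. borel) \<Otimes>\<^sub>M (\<Pi>\<^sub>M n\<in>UNIV. borel)) (\<lambda>\<omega>. (w \<omega>, w' \<omega>))"
    and P: "\<And>\<omega>. P \<omega> = discrete_measure (w \<omega>) (\<lambda>n. z n \<omega>)"
    and P': "\<And>\<omega>. P' \<omega> = discrete_measure (w' \<omega>) (\<lambda>n. z n \<omega>)"
    and D: "\<And>\<omega>. D \<omega> = kl_series (w \<omega>) (w' \<omega>)"
  shows
    "(AE \<omega> in M. absolutely_continuous (P' \<omega>) (P \<omega>) \<and>
        summable (\<lambda>n. w \<omega> n * ln (w \<omega> n / w' \<omega> n)) \<and>
        KL_divergence (exp 1) (P' \<omega>) (P \<omega>) = D \<omega>) \<and>
     integrable M D \<and>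
     integrable M (\<lambda>\<omega>. (D \<omega>)\<^sup>2) \<and>
     integrable M (\<lambda>\<omega>. binary_div (V 0 \<omega>) (v \<omega>)) \<and>
     integrable M (\<lambda>\<omega>. (binary_div (V 0 \<omega>) (v \<omega>))\<^sup>2) \<and>
     integrable M (\<lambda>\<omega>. (1 - V 0 \<omega>) * binary_div (V 0 \<omega>) (v \<omega>) * binary_div (V 1 \<omega>) (v \<omega>)) \<and>
     prob_space.expectation M D =
       (\<theta> + 1) * prob_space.expectation M (\<lambda>\<omega>. binary_div (V 0 \<omega>) (v \<omega>)) \<and>
     prob_space.expectation M (\<lambda>\<omega>. binary_div (V 0 \<omega>) (v \<omega>)) =
       \<rho> * (Digamma 2 - Digamma (\<theta> + 2) - Digamma a + Digamma (a + b))
       + (1 - \<rho>) * (- \<rho> - Digamma b + Digamma (a + b)) \<and>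
     prob_space.variance M D =
       (\<theta> + 1) * (\<theta> + 2) * prob_space.expectation M
         (\<lambda>\<omega>. (1 - V 0 \<omega>) * binary_div (V 0 \<omega>) (v \<omega>) * binary_div (V 1 \<omega>) (v \<omega>))
       + (\<theta> + 2) / 2 * prob_space.expectation M (\<lambda>\<omega>. (binary_div (V 0 \<omega>) (v \<omega>))\<^sup>2)
       - ((\<theta> + 1) * prob_space.expectation M (\<lambda>\<omega>. binary_div (V 0 \<omega>) (v \<omega>)))\<^sup>2"
proof -
  interpret stick_breaking M \<theta> a b V v
    by (intro stick_breaking.intro stick_breaking_axioms.intro M pos V_distr V_indep v_distr v_indep)
  have D_KL: "D = KL"
    by (simp add: fun_eq_iff D w w' KL_def)
  have div_eq: "binary_div (V n \<omega>) (v \<omega>) = stick_div n \<omega>" for n \<omega>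
    by (simp add: stick_div_def)
  have "1 - \<rho> = \<theta> / (\<theta> + 1)" using pos rho by (simp add: field_simps)
  have expectation_formula: "expectation (\<lambda>\<omega>. binary_div (V 0 \<omega>) (v \<omega>)) =
       \<rho> * (Digamma 2 - Digamma (\<theta> + 2) - Digamma a + Digamma (a + b))
       + (1 - \<rho>) * (- \<rho> - Digamma b + Digamma (a + b))"
    using expectation_stick_div unfolding div_eq \<open>1 - \<rho> = _\<close> by (simp only: rho)
  have KL: "AE \<omega> in M. absolutely_continuous (P' \<omega>) (P \<omega>) \<and>
        summable (\<lambda>n. w \<omega> n * ln (w \<omega> n / w' \<omega> n)) \<and>
        KL_divergence (exp 1) (P' \<omega>) (P \<omega>) = D \<omega>"
    using AE_KL_sums AE_unit AE_inj_iid_nonatomic[OF z_indep z_distr(2) P0_nonatomic]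
  proof eventually_elim
    case (elim \<omega>)
    have pos: "0 < w \<omega> n" "0 < w' \<omega> n" for n
      using elim by (auto simp: w w' stick_weight_def geometric_weight_def intro!: mult_pos_pos prod_pos)
    have "summable (w' \<omega>)"
      unfolding w' geometric_weight_def [abs_def]
      using elim by (intro summable_mult summable_geometric) auto
    moreover have "summable (\<lambda>n. w \<omega> n * ln (w \<omega> n / w' \<omega> n))"
      using elim by (auto simp: w w' sums_iff)
    ultimately show ?case
      using KL_divergence_discrete_measure[of "\<lambda>n. z n \<omega>" "w \<omega>" "w' \<omega>"] pos elim
      by (simp add: P P' D)
  qed
  show ?thesis
    using KL integrable_stick_div[of 0] integrable_stick_div_sq[of 0] integrable_compl_div_div
      has_bochner_integral_KL has_bochner_integral_KL_sq variance_KL expectation_formula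
    unfolding D_KL div_eq by (simp add: has_bochner_integral_iff)
qed

end
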